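(* Let $f\in\mathbb{Q}[x]$ be an irreducible polynomial with Galois group $G$ (the Galois group over $\mathbb{Q}$ of the splitting field of $f$), and let $\alpha\in\overline{\mathbb{Q}}$ be any root of $f$. Then $$\operatorname{gw}(\alpha)=\operatorname{gw}(G).$$
   Context: $\overline{\mathbb{Q}}\subset\mathbb{C}$ is the field of algebraic numbers; a number field is a subfield of $\overline{\mathbb{Q}}$ that is a finite extension of $\mathbb{Q}$. Galois width of an algebraic number. For $\alpha\in\overline{\mathbb{Q}}$, an algorithm computing $\alpha$ is a finite tower of number fields $\mathbb{Q}=\mathbb{F}_0\subset\mathbb{F}_1\subset\cdots\subset\mathbb{F}_m$ (inclusions need not be strict, $m$ is arbitrary) with $\alpha\in\mathbb{F}_m$. The Galois width of $\alpha$ is $$\operatorname{gw}(\alpha)=\min_{\mathbb{Q}=\mathbb{F}_0\subset\cdots\subset\mathbb{F}_m\ni\alpha}\ \Big(\max_{0\le i<m}[\mathbb{F}_{i+1}:\mathbb{F}_i]\Big),$$ the minimum being over all algorithms computing $\alpha$. Galois width of a finite group. For a finite group $G$, the cost of a chain of subgroups $H_0\ge H_1\ge\cdots\ge H_n$ is $\max_{0\le i\le n-1}[H_i:H_{i+1}]$. A chain $G=H_0>H_1>\cdots>H_n=\mathrm{id}$ with strict inclusions is maximal if it cannot be refined to a longer chain by inserting strict subgroups. The Galois width $\operatorname{gw}(G)$ is the minimum cost over all maximal chains of subgroups $G=H_0>\cdots>H_n=\mathrm{id}$. Convention: the maximum over an empty set of indices is $1$ (so the trivial group and rational numbers have Galois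 width $1$). *)

theory Defs
  imports "HOL-Algebra.Algebra" "HOL-Algebra.Algebraic_Closure_Type" "HOL-Library.Sublist"
begin

text \<open>
  All number fields are subfields of the complex numbers, so they are represented by their
  carriers, as subsets of the following ring.
\<close>

abbreviation CC :: "complex ring" where
  "CC \<equiv> ring_of_type_algebra"

definition chain_cost :: "('a \<Rightarrow> 'a \<Rightarrow> nat) \<Rightarrow> 'a list \<Rightarrow> nat" where
  "chain_cost d xs =
     (if length xs \<le> 1 then 1 else Max {d (xs ! i) (xs ! Suc i) | i. Suc i < length xs})"


section \<open>Galois width of an algebraic number\<close>

definition number_field :: "complex set \<Rightarrow> bool" where
  "number_field F \<longleftrightarrow>
     subfield F CC \<and> F \<subseteq> {z. algebraic z} \<and> ring.finite_dimension CC \<rat> F"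

definition algorithm_computing :: "complex \<Rightarrow> complex set list \<Rightarrow> bool" where
  "algorithm_computing \<alpha> Fs \<longleftrightarrow>
     Fs \<noteq> [] \<and> hd Fs = \<rat> \<and> (\<forall>F\<in>set Fs. number_field F) \<and> successively (\<subseteq>) Fs \<and> \<alpha> \<in> last Fs"

text \<open>
  \<open>ring.dim CC K L\<close> is the degree \<open>[L : K]\<close>. The minimum is attained when \<open>\<alpha>\<close> is algebraic,
  and is unspecified otherwise.
\<close>

definition number_galois_width :: "complex \<Rightarrow> nat" where
  "number_galois_width \<alpha> =
     (LEAST c. \<exists>Fs. algorithm_computing \<alpha> Fs \<and> c = chain_cost (\<lambda>K L. ring.dim CC K L) Fs)"


section \<open>Galois width of a finite group\<close>

definition subgroup_index :: "('a, 'b) monoid_scheme \<Rightarrow> 'a set \<Rightarrow> 'a set \<Rightarrow> nat" where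
  "subgroup_index G H K = card (rcosets\<^bsub>G\<lparr>carrier := H\<rparr>\<^esub> K)"

text \<open>
  Since the refined chain must again run from \<open>G\<close> to the trivial subgroup, it can only gain
  subgroups strictly between two consecutive members.
\<close>

definition subgroup_chain :: "('a, 'b) monoid_scheme \<Rightarrow> 'a set list \<Rightarrow> bool" where
  "subgroup_chain G Hs \<longleftrightarrow>
     Hs \<noteq> [] \<and> hd Hs = carrier G \<and> last Hs = {\<one>\<^bsub>G\<^esub>} \<and>
     (\<forall>H\<in>set Hs. subgroup H G) \<and> successively (\<supset>) Hs"

definition maximal_subgroup_chain :: "('a, 'b) monoid_scheme \<Rightarrow> 'a set list \<Rightarrow> bool" where
  "maximal_subgroup_chain G Hs \<longleftrightarrow>
     subgroup_chain G Hs \<and> (\<nexists>Ks. subgroup_chain G Ks \<and> strict_subseq Hs Ks)"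

definition group_galois_width :: "('a, 'b) monoid_scheme \<Rightarrow> nat" where
  "group_galois_width G =
     (LEAST c. \<exists>Hs. maximal_subgroup_chain G Hs \<and> c = chain_cost (subgroup_index G) Hs)"


section \<open>The Galois group of a rational polynomial\<close>

definition complex_roots :: "rat poly \<Rightarrow> complex set" where
  "complex_roots f = {z. poly (map_poly of_rat f) z = 0}"

definition splitting_field :: "rat poly \<Rightarrow> complex set" where
  "splitting_field f = generate_field CC (\<rat> \<union> complex_roots f)"

text \<open>
  As in \<^const>\<open>AutoGroup\<close>, automorphisms of \<open>L\<close> are extensional functions, so that each field
  automorphism is represented by exactly one HOL function.
\<close>

definition galois_group :: "complex set \<Rightarrow> complex set \<Rightarrow> (complex \<Rightarrow> complex) monoid" where
  "galois_group L K =
     BijGroup L \<lparr>carrier := {\<sigma> \<in> Bij L.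
       \<sigma> \<in> ring_hom (CC\<lparr>carrier := L\<rparr>) (CC\<lparr>carrier := L\<rparr>) \<and> (\<forall>x\<in>K. \<sigma> x = x)}\<rparr>"

end

theory Submission
  imports Defs
begin

text \<open>
  Write \<open>L\<close> for the splitting field of \<open>f\<close> and \<open>G\<close> for its Galois group. Both inequalities
  follow from the Galois correspondence, of which only two estimates are needed: the index of
  consecutive subgroups bounds the degree of their fixed fields, and the degree of consecutive
  fields bounds the index of their stabilisers.

  For \<open>gw(\<alpha>) \<le> gw(G)\<close>, the fixed fields of a chain from \<open>G\<close> to the trivial group form a tower
  from \<open>\<rat>\<close> to \<open>L\<close>, which contains \<open>\<alpha>\<close>. If \<open>H' \<le> H\<close> are consecutive groups and \<open>\<kappa>\<close> is a primitive
  element of the fixed field of \<open>H'\<close>, then \<open>\<kappa>\<close> is a root of the product of \<open>X - x\<close> over the orbit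
  \<open>H \<kappa>\<close>. This product has coefficients in the fixed field of \<open>H\<close>, and the orbit has at most
  \<open>[H : H']\<close> elements because \<open>H'\<close> fixes \<open>\<kappa>\<close> (\<open>dim_fixed_field_le_subgroup_index\<close>).

  For \<open>gw(G) \<le> gw(\<alpha>)\<close>, take a tower with all degrees at most \<open>k\<close> whose top contains \<open>\<alpha>\<close>. The
  top lies in a splitting field \<open>M\<close>, and \<open>M\<close> contains \<open>L\<close>; let \<open>\<Gamma>\<close> be the group of
  automorphisms of \<open>M\<close>. The pointwise stabilisers of the fields form a descending chain in \<open>\<Gamma>\<close> with
  indices at most \<open>k\<close>: if \<open>F = K(\<kappa>)\<close>, then the stabiliser of \<open>K\<close> moves \<open>\<kappa>\<close> only to roots of its
  minimal polynomial over \<open>K\<close> (\<open>index_bounded_field_autos\<close>). The last stabiliser fixes \<open>\<alpha>\<close>, but it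
  need not act trivially on \<open>L\<close>. Conjugating a chain, and intersecting it with a subgroup, preserves the
  bound \<open>k\<close> on the indices, so the chain can be prolonged to the intersection of all conjugates of the
  last stabiliser (\<open>index_bounded_chain_conjugates\<close>). This intersection fixes every conjugate of \<open>\<alpha>\<close>,
  hence all roots of \<open>f\<close> and all of \<open>L\<close>. Restriction to \<open>L\<close> maps \<open>\<Gamma>\<close> onto \<open>G\<close> and does not
  increase indices, so it produces a chain from \<open>G\<close> to the trivial group with indices at most \<open>k\<close>.
  Refining it cannot increase the cost (\<open>maximal_subgroup_chain_exists\<close>).

  The field theory behind this rests on the primitive element theorem (\<open>primitive_element\<close>), on
  the extension of \<open>\<theta> \<mapsto> t\<close> to an automorphism of \<open>\<rat>(\<theta>)\<close> when this field is a splitting field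
  and \<open>t\<close> is a conjugate of \<open>\<theta>\<close> (\<open>splitting_field_automorphism_exists\<close>), and on the consequences
  that only rational numbers are fixed by all automorphisms (\<open>galois_fixed_field_Rats\<close>) and that
  conjugate elements are related by an automorphism (\<open>galois_transitive\<close>).
\<close>


section \<open>Subfields of the complex numbers\<close>

lemma field_CC: "Ring.field CC"
  by (rule field_from_type_algebra)

interpretation CC: Ring.domain CC
  using field_CC by (rule field.axioms)

lemma CC_simps [simp]:
  "carrier CC = UNIV" "x \<otimes>\<^bsub>CC\<^esub> y = x * y" "x \<oplus>\<^bsub>CC\<^esub> y = x + y"
  "\<one>\<^bsub>CC\<^esub> = 1" "\<zero>\<^bsub>CC\<^esub> = 0"
  by (simp_all add: ring_of_type_algebra_def)

lemma CC_a_inv [simp]: "\<ominus>\<^bsub>CC\<^esub> x = - x"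
  using CC.minus_equality[of "- x" x] by simp

lemma CC_inv: "x \<noteq> 0 \<Longrightarrow> inv\<^bsub>CC\<^esub> x = inverse x"
  using CC.inv_char[of x "inverse x"] by simp

lemma CC_nat_pow [simp]: "x [^]\<^bsub>CC\<^esub> (n::nat) = x ^ n"
  by (induction n) auto

lemma subfield_CCD:
  assumes "subfield K CC"
  shows "0 \<in> K" "1 \<in> K" "x \<in> K \<Longrightarrow> y \<in> K \<Longrightarrow> x + y \<in> K" "x \<in> K \<Longrightarrow> y \<in> K \<Longrightarrow> x * y \<in> K"
    "x \<in> K \<Longrightarrow> - x \<in> K" "x \<in> K \<Longrightarrow> y \<in> K \<Longrightarrow> x - y \<in> K" "x \<in> K \<Longrightarrow> inverse x \<in> K"
    "x \<in> K \<Longrightarrow> y \<in> K \<Longrightarrow> x / y \<in> K"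
proof -
  note sr = subringE[OF subfieldE(1)[OF assms]]
  show *: "0 \<in> K" "1 \<in> K" "x \<in> K \<Longrightarrow> y \<in> K \<Longrightarrow> x + y \<in> K" "x \<in> K \<Longrightarrow> y \<in> K \<Longrightarrow> x * y \<in> K"
    "x \<in> K \<Longrightarrow> - x \<in> K" for x y
    using sr(2,3) sr(5)[of x] sr(6)[of x y] sr(7)[of x y] by simp_all
  show "x \<in> K \<Longrightarrow> y \<in> K \<Longrightarrow> x - y \<in> K" for x y
    using *(3)[of x "-y"] *(5)[of y] by simp
  show inv: "x \<in> K \<Longrightarrow> inverse x \<in> K" for x
    using CC.subfield_m_inv(1)[OF assms, of x] *(1) by (cases "x = 0") (auto simp: CC_inv)
  show "x \<in> K \<Longrightarrow> y \<in> K \<Longrightarrow> x / y \<in> K" for x y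
    using *(4)[of x "inverse y"] inv[of y] by (simp add: divide_inverse)
qed

lemma subfield_CCI:
  assumes "0 \<in> K" "1 \<in> K" "\<And>x y. x \<in> K \<Longrightarrow> y \<in> K \<Longrightarrow> x + y \<in> K"
    "\<And>x y. x \<in> K \<Longrightarrow> y \<in> K \<Longrightarrow> x * y \<in> K" "\<And>x. x \<in> K \<Longrightarrow> - x \<in> K"
    "\<And>x. x \<in> K \<Longrightarrow> inverse x \<in> K"
  shows "subfield K CC"
  by (rule field.subfieldI'[OF field_CC]) (auto intro!: CC.subringI assms simp: CC_inv)

lemma subfield_Rats: "subfield \<rat> CC"
  by (rule subfield_CCI) auto

lemma Rats_subset_subfield:
  assumes "subfield K CC"
  shows "\<rat> \<subseteq> K"
proof -
  have nat: "of_nat n \<in> K" for n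
    by (induction n) (auto intro: subfield_CCD[OF assms])
  have int: "of_int n \<in> K" for n
    by (cases n rule: int_cases2) (auto intro: nat subfield_CCD[OF assms])
  show ?thesis
    by (auto elim!: Rats_cases' intro: int subfield_CCD[OF assms])
qed

lemma subfield_sum: "subfield K CC \<Longrightarrow> (\<And>i. i \<in> I \<Longrightarrow> f i \<in> K) \<Longrightarrow> sum f I \<in> K"
  by (induction I rule: infinite_finite_induct) (auto intro: subfield_CCD)

lemma subfield_of_nat: "subfield K CC \<Longrightarrow> of_nat n \<in> K"
  using Rats_subset_subfield[of K] by auto


section \<open>Minimal polynomials over a subfield\<close>

text \<open>
  The polynomials with coefficients in \<open>K\<close> are represented as complex polynomials, so that
  divisibility and roots always refer to the algebraically closed field of complex numbers.
\<close>

definition polys_over :: "complex set \<Rightarrow> complex poly set" where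
  "polys_over K = {p. \<forall>i. Polynomial.coeff p i \<in> K}"

lemma polys_over_mono: "K \<subseteq> L \<Longrightarrow> polys_over K \<subseteq> polys_over L"
  by (auto simp: polys_over_def)

lemma polys_over_0: "subfield K CC \<Longrightarrow> 0 \<in> polys_over K"
  by (simp add: polys_over_def subfield_CCD)

lemma polys_over_pCons [simp]:
  "subfield K CC \<Longrightarrow> pCons a p \<in> polys_over K \<longleftrightarrow> a \<in> K \<and> p \<in> polys_over K"
  by (force simp: polys_over_def coeff_pCons split: nat.splits)

lemma polys_over_add: "subfield K CC \<Longrightarrow> p \<in> polys_over K \<Longrightarrow> q \<in> polys_over K \<Longrightarrow> p + q \<in> polys_over K"
  by (simp add: polys_over_def subfield_CCD)

lemma polys_over_mult: "subfield K CC \<Longrightarrow> p \<in> polys_over K \<Longrightarrow> q \<in> polys_over K \<Longrightarrow> p * q \<in> polys_over K"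
  by (auto simp: polys_over_def coeff_mult intro!: subfield_sum subfield_CCD)

lemma polys_over_pcompose:
  assumes "subfield K CC" "p \<in> polys_over K" "q \<in> polys_over K"
  shows "pcompose p q \<in> polys_over K"
  using assms(2)
  by (induction p) (auto simp: pcompose_pCons assms polys_over_0 intro!: polys_over_add polys_over_mult)

lemma polys_over_pderiv: "subfield K CC \<Longrightarrow> p \<in> polys_over K \<Longrightarrow> pderiv p \<in> polys_over K"
  by (simp add: polys_over_def coeff_pderiv subfield_CCD subfield_of_nat del: of_nat_Suc)

text \<open>
  A list of coefficients starts with the leading one; this lemma translates it into a polynomial
  of type \<^typ>\<open>complex poly\<close>.
\<close>

lemma eval_CC: "ring.eval CC p x = poly (Poly (rev p)) x"
proof (induction p)
  case (Cons a p)
  then show ?case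
    by (simp add: Poly_append poly_monom mult.commute)
qed simp

lemma Poly_rev_in_polys_over:
  assumes "subfield K CC" "p \<in> carrier (univ_poly CC K)"
  shows "Poly (rev p) \<in> polys_over K"
proof -
  have "set p \<subseteq> K"
    using assms(2) by (auto simp: univ_poly_carrier[symmetric] polynomial_def)
  then show ?thesis
    using subfield_CCD(1)[OF assms(1)]
    by (auto simp: polys_over_def coeff_Poly_eq nth_default_def)
      (metis in_mono nth_mem length_rev set_rev)
qed

lemma rev_coeffs_in_univ_poly:
  assumes "subfield K CC" "p \<in> polys_over K"
  shows "rev (coeffs p) \<in> carrier (univ_poly CC K)"
  using assms(2) unfolding univ_poly_carrier[symmetric] polynomial_def polys_over_def
  by (auto simp: hd_rev last_coeffs_eq_coeff_degree coeffs_def split: if_splits)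

text \<open>
  For a subfield \<open>K\<close>, \<open>adjoin K x\<close> is \<open>K[x]\<close>, the smallest subring containing \<open>K\<close> and \<open>x\<close>; it is
  the field \<open>K(x)\<close> if \<open>x\<close> is algebraic over \<open>K\<close>.
\<close>

abbreviation adjoin :: "complex set \<Rightarrow> complex \<Rightarrow> complex set" where
  "adjoin K x \<equiv> ring.simple_extension CC K x"

abbreviation alg_over :: "complex set \<Rightarrow> complex \<Rightarrow> bool" where
  "alg_over K x \<equiv> (ring.algebraic CC over K) x"

lemma adjoin_eq_polys:
  assumes "subfield K CC"
  shows "adjoin K x = (\<lambda>p. poly p x) ` polys_over K" (is "?A = ?B")
proof -
  have 1: "?A = (\<lambda>p. ring.eval CC p x) ` carrier (univ_poly CC K)"
    by (rule CC.simple_extension_as_eval_img) auto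
  show ?thesis
  proof (intro equalityI subsetI)
    fix y assume "y \<in> ?A"
    then show "y \<in> ?B"
      using Poly_rev_in_polys_over[OF assms] by (auto simp: 1 eval_CC)
  next
    fix y assume "y \<in> ?B"
    then obtain p where "p \<in> polys_over K" "y = poly p x" by auto
    then show "y \<in> ?A"
      using rev_coeffs_in_univ_poly[OF assms, of p] by (auto simp: 1 eval_CC intro!: image_eqI[of _ _ "rev (coeffs p)"])
  qed
qed

lemma algebraic_over_iff:
  assumes "subfield K CC"
  shows "alg_over K x \<longleftrightarrow> (\<exists>p\<in>polys_over K. p \<noteq> 0 \<and> poly p x = 0)"
proof
  assume "alg_over K x"
  then obtain p where p: "p \<in> carrier (univ_poly CC K)" "p \<noteq> []" "ring.eval CC p x = 0"
    using CC.algebraicE[OF subfieldE(1)[OF assms], of x] by auto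
  then have "Poly (rev p) \<noteq> 0"
    by (auto simp: univ_poly_carrier[symmetric] polynomial_def Poly_eq_0) (metis hd_in_set in_set_replicate set_rev)
  with p show "\<exists>p\<in>polys_over K. p \<noteq> 0 \<and> poly p x = 0"
    using Poly_rev_in_polys_over[OF assms p(1)] by (auto simp: eval_CC)
next
  assume "\<exists>p\<in>polys_over K. p \<noteq> 0 \<and> poly p x = 0"
  then obtain p where "p\<in>polys_over K" "p \<noteq> 0" "poly p x = 0" by auto
  then show "alg_over K x"
    using rev_coeffs_in_univ_poly[OF assms, of p]
    by (intro CC.algebraicI[of "rev (coeffs p)"]) (auto simp: eval_CC)
qed

text \<open>
  The monic minimal polynomial of \<open>x\<close> over \<open>K\<close>, as a complex polynomial. It is only meaningful if
  \<open>x\<close> is algebraic over \<open>K\<close>.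
\<close>

definition min_poly :: "complex set \<Rightarrow> complex \<Rightarrow> complex poly" where
  "min_poly K x = Poly (rev (ring.Irr CC K x))"

lemma min_poly:
  assumes K: "subfield K CC" and alg: "alg_over K x"
  shows min_poly_over: "min_poly K x \<in> polys_over K"
    and min_poly_nonzero: "min_poly K x \<noteq> 0"
    and min_poly_root: "poly (min_poly K x) x = 0"
    and min_poly_dvd: "p \<in> polys_over K \<Longrightarrow> poly p x = 0 \<Longrightarrow> min_poly K x dvd p"
    and dimension_adjoin:
      "ring.dimension CC (Polynomial.degree (min_poly K x)) K (adjoin K x)"
    and adjoin_low_degree:
      "y \<in> adjoin K x \<Longrightarrow>
        \<exists>p\<in>polys_over K. Polynomial.degree p < Polynomial.degree (min_poly K x) \<and> y = poly p x"
proof -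
  let ?I = "ring.Irr CC K x"
  note I = CC.IrrE[OF K _ alg, simplified]
  show "min_poly K x \<in> polys_over K" "poly (min_poly K x) x = 0"
    unfolding min_poly_def using Poly_rev_in_polys_over[OF K] I by (auto simp: eval_CC)
  have ne: "?I \<noteq> []"
    using I(2,1) by (metis CC.pirreducibleE(1) K subfieldE(1))
  then have l: "last (rev ?I) = 1"
    using I(3) by (simp add: last_rev)
  show nz: "min_poly K x \<noteq> 0"
    using ne l by (auto simp: min_poly_def Poly_eq_0) (metis last_in_set in_set_replicate rev_is_Nil_conv zero_neq_one last_rev)
  have "coeffs (min_poly K x) = rev ?I"
    unfolding min_poly_def coeffs_Poly
    by (rule strip_while_idem) (simp only: no_trailing_unfold l, simp)
  then have deg: "Polynomial.degree (min_poly K x) = length ?I - 1"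
    by (simp add: degree_eq_length_coeffs)
  show "ring.dimension CC (Polynomial.degree (min_poly K x)) K (adjoin K x)"
    using CC.dimension_simple_extension[OF K _ alg] by (simp add: deg)
  show "\<exists>p\<in>polys_over K. Polynomial.degree p < Polynomial.degree (min_poly K x) \<and> y = poly p x"
    if y: "y \<in> adjoin K x"
  proof -
    have "0 < Polynomial.degree (min_poly K x)"
    proof (rule ccontr)
      assume "\<not> ?thesis"
      then obtain c where "min_poly K x = [:c:]" by (auto elim: degree_eq_zeroE)
      then show False using nz \<open>poly (min_poly K x) x = 0\<close> by simp
    qed
    moreover obtain p where p: "p \<in> carrier (univ_poly CC K)"
      "length p \<le> Polynomial.degree (min_poly K x)" "y = poly (Poly (rev p)) x"
    proof -
      have "y \<in> (\<lambda>p. ring.eval CC p x) ` {p \<in> carrier (univ_poly CC K). length p \<le> length ?I - 1}"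
        using y CC.Span_exp_base[OF K _ alg] CC.Span_eq_eval_img[OF K, of x "length ?I - 1"] by simp
      then show ?thesis
        using that by (auto simp: deg eval_CC)
    qed
    ultimately have "Polynomial.degree (Poly (rev p)) < Polynomial.degree (min_poly K x)"
      by (intro degree_lessI) (auto simp: nth_default_def)
    then show ?thesis
      using Poly_rev_in_polys_over[OF K p(1)] p(3) by blast
  qed
  show "min_poly K x dvd p" if p: "p \<in> polys_over K" "poly p x = 0"
  proof -
    let ?p = "rev (coeffs p)"
    have "?I pdivides\<^bsub>CC\<^esub> ?p"
      using CC.Irr_minimal[OF K _ alg rev_coeffs_in_univ_poly[OF K p(1)]] p(2) by (simp add: eval_CC)
    then obtain q where q: "q \<in> carrier (univ_poly CC UNIV)" "?p = ring.poly_mult CC ?I q"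
      by (auto simp: pdivides_def factor_def univ_poly_mult)
    have *: "set ?I \<subseteq> carrier CC" "set q \<subseteq> carrier CC" by auto
    have "poly p z = poly (min_poly K x * Poly (rev q)) z" for z
    proof -
      have "poly p z = ring.eval CC ?p z" by (simp add: eval_CC)
      also have "\<dots> = ring.eval CC ?I z * ring.eval CC q z"
        using CC.eval_poly_mult[OF *, of z] by (simp add: q(2))
      finally show ?thesis by (simp add: eval_CC min_poly_def)
    qed
    then have "p = min_poly K x * Poly (rev q)"
      by (metis poly_eq_poly_eq_iff ext)
    then show ?thesis by simp
  qed
qed


text \<open>By uniqueness of monic irreducible annihilators, all roots of a minimal polynomial share it.\<close>

lemma min_poly_conjugate:
  assumes K: "subfield K CC" and alg: "alg_over K x" and a: "poly (min_poly K x) a = 0"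
  shows "alg_over K a" "min_poly K a = min_poly K x"
proof -
  show alg': "alg_over K a"
    using min_poly[OF K alg] a by (auto simp: algebraic_over_iff[OF K])
  have "\<exists>!p \<in> carrier (univ_poly CC K).
      ring_irreducible\<^bsub>univ_poly CC K\<^esub> p \<and> ring.eval CC p a = 0 \<and> hd p = 1"
    using CC.minimal_polynomial_is_unique[OF K _ alg'] by simp
  moreover have "poly (Poly (rev (ring.Irr CC K x))) a = 0"
    using a by (simp add: min_poly_def)
  ultimately have "ring.Irr CC K a = ring.Irr CC K x"
    using CC.IrrE[OF K _ alg', simplified] CC.IrrE[OF K _ alg, simplified]
    unfolding eval_CC by blast
  then show "min_poly K a = min_poly K x"
    by (simp add: min_poly_def)
qed

lemma degree_min_poly_pos:
  assumes "subfield K CC" "alg_over K x"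
  shows "0 < Polynomial.degree (min_poly K x)"
proof (rule ccontr)
  assume "\<not> ?thesis"
  then obtain c where "min_poly K x = [:c:]" by (auto elim: degree_eq_zeroE)
  then show False using min_poly_nonzero[OF assms] min_poly_root[OF assms] by simp
qed

text \<open>
  Minimal polynomials are separable: a multiple root would also be a root of the derivative, which
  is nonzero of smaller degree.
\<close>

lemma rsquarefree_min_poly:
  assumes K: "subfield K CC" and alg: "alg_over K x"
  shows "rsquarefree (min_poly K x)"
  unfolding rsquarefree_roots
proof (intro allI notI)
  fix a assume a: "poly (min_poly K x) a = 0 \<and> poly (pderiv (min_poly K x)) a = 0"
  note c = min_poly_conjugate[OF K alg conjunct1[OF a]]
  have "min_poly K x dvd pderiv (min_poly K x)"
    using min_poly_dvd[OF K c(1), of "pderiv (min_poly K x)"] a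
    by (simp add: c(2) polys_over_pderiv[OF K min_poly_over[OF K alg]])
  moreover have "pderiv (min_poly K x) \<noteq> 0"
    using degree_min_poly_pos[OF K alg] by (simp add: pderiv_eq_0_iff)
  ultimately have "Polynomial.degree (min_poly K x) \<le> Polynomial.degree (min_poly K x) - 1"
    using dvd_imp_degree_le[of "min_poly K x" "pderiv (min_poly K x)"] by (simp add: degree_pderiv)
  then show False
    using degree_min_poly_pos[OF K alg] by linarith
qed

lemma card_roots_rsquarefree:
  assumes "rsquarefree (p :: complex poly)"
  shows "card {z. poly p z = 0} = Polynomial.degree p"
proof -
  have "p \<noteq> 0" using assms by (auto simp: rsquarefree_def)
  then have fin: "finite {z. poly p z = 0}" by (rule poly_roots_finite)
  have "Polynomial.degree p
      = Polynomial.degree (Polynomial.smult (lead_coeff p) (\<Prod>z|poly p z = 0. [:-z, 1:]))"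
    by (simp only: complex_poly_decompose_rsquarefree[OF assms])
  also have "\<dots> = Polynomial.degree (\<Prod>z|poly p z = 0. [:-z, 1:])"
    using \<open>p \<noteq> 0\<close> by simp
  also have "\<dots> = card {z. poly p z = 0}"
    by (subst degree_prod_sum_eq) auto
  finally show ?thesis ..
qed

section \<open>The primitive element theorem\<close>

lemma subfield_adjoin:
  assumes "subfield K CC" "alg_over K x"
  shows "subfield (adjoin K x) CC"
  using CC.simple_extension_is_subfield[OF assms(1)] assms(2) by simp

lemma adjoin_incl: "K \<subseteq> adjoin K x"
  using CC.simple_extension_incl[of K x] by simp

lemma adjoin_mem: "subfield K CC \<Longrightarrow> x \<in> adjoin K x"
  using CC.simple_extension_mem[OF subfieldE(1)] by simp

lemma adjoin_least:
  assumes "subfield F CC" "K \<subseteq> F" "x \<in> F"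
  shows "adjoin K x \<subseteq> F"
  using CC.simple_extension_subring_incl[OF subfieldE(1)[OF assms(1)] assms(2,3)] .

lemma alg_over_mono: "K \<subseteq> F \<Longrightarrow> alg_over K x \<Longrightarrow> alg_over F x"
  using CC.algebraic_mono[of K F x] by (simp add: over_def)

lemma subfield_alg_over: "subfield K CC \<Longrightarrow> subfield {x. alg_over K x} CC"
  using field.subfield_of_algebraics[OF field_CC] by simp

lemma poly_root_dvd_mono: "p dvd q \<Longrightarrow> poly p z = 0 \<Longrightarrow> poly q z = 0"
  by (auto simp: dvd_def)

text \<open>
  With \<open>c = a + n b\<close>, the element \<open>b\<close> is a common root of its minimal polynomial over \<open>K\<close> and of
  \<open>h(X) = m(c - n X)\<close>, where \<open>m\<close> is the minimal polynomial of \<open>a\<close> over \<open>K\<close>. For all but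
  finitely many \<open>n\<close> it is the only common root, and then the minimal polynomial of \<open>b\<close> over
  \<open>K(c)\<close>, which divides both and is separable, is linear.
\<close>

lemma primitive_element_two_generators:
  assumes K: "subfield K CC" and a: "alg_over K a" and b: "alg_over K b"
  obtains n :: nat where "alg_over K (a + of_nat n * b)"
    "a \<in> adjoin K (a + of_nat n * b)" "b \<in> adjoin K (a + of_nat n * b)"
proof -
  define A where "A = {z. poly (min_poly K a) z = 0}"
  define B where "B = {z. poly (min_poly K b) z = 0}"
  have fin: "finite A" "finite B"
    unfolding A_def B_def using min_poly_nonzero[OF K a] min_poly_nonzero[OF K b]
    by (auto intro: poly_roots_finite)
  \<comment> \<open>The excluded values of \<open>n\<close> include all those for which \<open>c - n v\<close> is a conjugate \<open>u\<close> of \<open>a\<close> for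
    some conjugate \<open>v \<noteq> b\<close> of \<open>b\<close>.\<close>
  have "infinite (range (of_nat :: nat \<Rightarrow> complex))"
    by (rule range_inj_infinite[OF inj_of_nat])
  moreover have "finite ((\<lambda>(u, v). (u - a) / (b - v)) ` (A \<times> B))"
    using fin by simp
  ultimately have "\<not> range (of_nat :: nat \<Rightarrow> complex) \<subseteq> (\<lambda>(u, v). (u - a) / (b - v)) ` (A \<times> B)"
    using finite_subset by blast
  then obtain n :: nat where n: "of_nat n \<notin> (\<lambda>(u, v). (u - a) / (b - v)) ` (A \<times> B)"
    by blast
  define c where "c = a + of_nat n * b"
  have "of_nat n \<in> {x. alg_over K x}"
    using subfield_of_nat[OF subfield_alg_over[OF K]] by blast
  then have c: "alg_over K c"
    using subfield_CCD(3)[OF subfield_alg_over[OF K], of a "of_nat n * b"]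
      subfield_CCD(4)[OF subfield_alg_over[OF K], of "of_nat n" b] a b
    unfolding c_def by blast
  define F where "F = adjoin K c"
  have F: "subfield F CC" unfolding F_def by (rule subfield_adjoin[OF K c])
  have KF: "K \<subseteq> F" unfolding F_def by (rule adjoin_incl)
  have cF: "c \<in> F" unfolding F_def by (rule adjoin_mem[OF K])
  have nF: "of_nat n \<in> F" by (rule subfield_of_nat[OF F])
  have bF: "alg_over F b" using alg_over_mono[OF KF b] .
  let ?m = "min_poly F b"
  let ?h = "pcompose (min_poly K a) [:c, - of_nat n:]"
  have "?h \<in> polys_over F"
  proof (rule polys_over_pcompose[OF F])
    show "min_poly K a \<in> polys_over F"
      using min_poly_over[OF K a] polys_over_mono[OF KF] by blast
    show "[:c, - of_nat n:] \<in> polys_over F"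
      using F cF subfield_CCD(5)[OF F nF] by (simp add: polys_over_0)
  qed
  then have dvd1: "?m dvd ?h"
    by (rule min_poly_dvd[OF F bF]) (use min_poly_root[OF K a] in \<open>simp add: poly_pcompose c_def\<close>)
  have dvd2: "?m dvd min_poly K b"
    using min_poly_dvd[OF F bF _ min_poly_root[OF K b]] min_poly_over[OF K b] polys_over_mono[OF KF]
    by blast
  have "{z. poly ?m z = 0} \<subseteq> {b}"
  proof
    fix z assume "z \<in> {z. poly ?m z = 0}"
    then have z: "z \<in> B" "c - of_nat n * z \<in> A"
      using poly_root_dvd_mono[OF dvd1, of z] poly_root_dvd_mono[OF dvd2, of z]
      by (auto simp: A_def B_def poly_pcompose mult.commute)
    show "z \<in> {b}"
    proof (rule ccontr)
      assume "z \<notin> {b}"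
      moreover have "c - of_nat n * z - a = of_nat n * (b - z)"
        by (simp add: c_def algebra_simps)
      ultimately have "of_nat n = (\<lambda>(u, v). (u - a) / (b - v)) (c - of_nat n * z, z)"
        by simp
      then show False using n z by blast
    qed
  qed
  then have "card {z. poly ?m z = 0} \<le> card {b}"
    by (intro card_mono) auto
  then have "Polynomial.degree ?m \<le> 1"
    by (simp add: card_roots_rsquarefree[OF rsquarefree_min_poly[OF F bF]])
  then have "Polynomial.degree ?m = 1"
    using degree_min_poly_pos[OF F bF] by linarith
  then obtain u v where uv: "?m = [:u, v:]" "v \<noteq> 0"
    by (metis degree_pCons_eq_if degree_eq_zeroE nat.inject One_nat_def pCons_cases pCons_eq_0_iff zero_neq_one)
  have "u \<in> F" "v \<in> F"
    using min_poly_over[OF F bF] F by (auto simp: uv(1))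
  moreover have "b * v = - u"
    using min_poly_root[OF F bF] by (simp add: uv(1) eq_neg_iff_add_eq_0 add.commute)
  then have "b = - u / v"
    by (metis nonzero_eq_divide_eq uv(2))
  ultimately have bF': "b \<in> F"
    using subfield_CCD(8)[OF F subfield_CCD(5)[OF F]] by simp
  moreover have "a = c - of_nat n * b" by (simp add: c_def)
  ultimately have "a \<in> F"
    using subfield_CCD(6)[OF F cF subfield_CCD(4)[OF F nF bF']] by simp
  with bF' show ?thesis
    using that[of n] c by (simp only: c_def F_def)
qed

lemma dimension_mono:
  assumes "subfield K CC" "ring.dimension CC m K E" "ring.dimension CC n K F" "E \<subseteq> F"
  shows "m \<le> n" "m = n \<Longrightarrow> E = F"
proof -
  obtain Us where "ring.independent CC K Us" "length Us = m" "ring.Span CC K Us = E"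
      and "set Us \<subseteq> E"
    using CC.exists_base[OF assms(1,2)] CC.Span_base_incl[OF assms(1)] by auto
  then show "m \<le> n" "m = n \<Longrightarrow> E = F"
    using CC.independent_length_le_dimension[OF assms(1,3), of Us]
      CC.independent_length_eq_dimension[OF assms(1,3), of Us] assms(4) by auto
qed

text \<open>
  An element of \<open>F\<close> of maximal degree over \<open>K\<close> is primitive: together with any further element of
  \<open>F\<close> it generates a simple extension, whose degree cannot be larger.
\<close>

theorem primitive_element:
  assumes K: "subfield K CC" and F: "subfield F CC" and KF: "K \<subseteq> F"
    and alg: "\<And>x. x \<in> F \<Longrightarrow> alg_over K x"
    and bound: "\<And>x. x \<in> F \<Longrightarrow> Polynomial.degree (min_poly K x) \<le> N"
  obtains k where "k \<in> F" "F = adjoin K k"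
proof -
  have "\<exists>k. k \<in> F \<and> (\<forall>y. y \<in> F \<longrightarrow> Polynomial.degree (min_poly K y) \<le> Polynomial.degree (min_poly K k))"
    by (rule ex_has_greatest_nat[of _ 0 _ "Suc N"])
      (use subfield_CCD(1)[OF F] bound in \<open>auto simp: less_Suc_eq_le\<close>)
  then obtain k where k: "k \<in> F"
    and max: "\<And>y. y \<in> F \<Longrightarrow> Polynomial.degree (min_poly K y) \<le> Polynomial.degree (min_poly K k)"
    by auto
  have "b \<in> adjoin K k" if b: "b \<in> F" for b
  proof -
    obtain n where n: "alg_over K (k + of_nat n * b)"
      "k \<in> adjoin K (k + of_nat n * b)" "b \<in> adjoin K (k + of_nat n * b)"
      using primitive_element_two_generators[OF K alg[OF k] alg[OF b]] .
    define c where "c = k + of_nat n * b"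
    note n = n[folded c_def]
    have sub: "adjoin K k \<subseteq> adjoin K c"
      by (rule adjoin_least[OF subfield_adjoin[OF K n(1)] adjoin_incl n(2)])
    have "c \<in> F"
      unfolding c_def using k b subfield_of_nat[OF F] by (intro subfield_CCD[OF F]) auto
    then have "Polynomial.degree (min_poly K c) \<le> Polynomial.degree (min_poly K k)"
      by (rule max)
    then have "adjoin K k = adjoin K c"
      using dimension_mono[OF K dimension_adjoin[OF K alg[OF k]]
          dimension_adjoin[OF K n(1)] sub] by linarith
    then show ?thesis using n(3) by simp
  qed
  then have "F = adjoin K k"
    using adjoin_least[OF F KF k] by blast
  with k show ?thesis by (rule that)
qed

corollary primitive_element_finite_dimension:
  assumes K: "subfield K CC" and F: "subfield F CC" and KF: "K \<subseteq> F"
    and fin: "ring.finite_dimension CC K F"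
  obtains k where "k \<in> F" "F = adjoin K k"
proof -
  obtain N where N: "ring.dimension CC N K F"
    using fin by (auto simp: CC.finite_dimension_def)
  have alg: "alg_over K x" if "x \<in> F" for x
    using CC.finite_dimension_imp_algebraic[OF K subfieldE(1)[OF F] fin that] .
  have "Polynomial.degree (min_poly K x) \<le> N" if "x \<in> F" for x
    using dimension_mono(1)[OF K dimension_adjoin[OF K alg[OF that]] N
      adjoin_least[OF F KF that]] .
  from primitive_element[OF K F KF alg this] show ?thesis
    using that by auto
qed

lemma algebraic_iff_alg_over_Rats: "algebraic x \<longleftrightarrow> alg_over \<rat> x"
  by (auto simp: algebraic_altdef algebraic_over_iff[OF subfield_Rats] polys_over_def)

lemma number_field_adjoin:
  assumes "algebraic x"
  shows "number_field (adjoin \<rat> x)"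
  unfolding number_field_def
proof (intro conjI subsetI)
  have x: "alg_over \<rat> x" using assms by (simp add: algebraic_iff_alg_over_Rats)
  show "subfield (adjoin \<rat> x) CC" by (rule subfield_adjoin[OF subfield_Rats x])
  show "ring.finite_dimension CC \<rat> (adjoin \<rat> x)"
    using CC.finite_dimension_simple_extension[OF subfield_Rats] x by simp
  show "y \<in> {z. algebraic z}" if "y \<in> adjoin \<rat> x" for y
    using CC.simple_extesion_mem_imp_algebraic[OF subfield_Rats _ x that]
    by (simp add: algebraic_iff_alg_over_Rats)
qed

lemma number_field_primitive_element:
  assumes "number_field F"
  obtains x where "algebraic x" "x \<in> F" "F = adjoin \<rat> x"
proof -
  have F: "subfield F CC" "F \<subseteq> {z. algebraic z}" "ring.finite_dimension CC \<rat> F"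
    using assms by (auto simp: number_field_def)
  obtain x where "x \<in> F" "F = adjoin \<rat> x"
    using primitive_element_finite_dimension[OF subfield_Rats F(1) Rats_subset_subfield[OF F(1)] F(3)] .
  moreover from \<open>x \<in> F\<close> F(2) have "algebraic x" by auto
  ultimately show ?thesis by (intro that)
qed

text \<open>A primitive element over \<open>\<rat>\<close> is one over every intermediate field.\<close>

lemma adjoin_over_intermediate_field:
  assumes "subfield K CC" "subfield F CC" "K \<subseteq> F" "F = adjoin \<rat> x"
  shows "F = adjoin K x"
proof
  have "x \<in> F" unfolding assms(4) by (rule adjoin_mem[OF subfield_Rats])
  then show "adjoin K x \<subseteq> F"
    by (rule adjoin_least[OF assms(2,3)])
  show "F \<subseteq> adjoin K x"
    unfolding assms(4) by (rule CC.mono_simple_extension[OF Rats_subset_subfield[OF assms(1)]])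
qed

lemma dim_eq_degree_min_poly:
  assumes "subfield K CC" "alg_over K x"
  shows "ring.dim CC K (adjoin K x) = Polynomial.degree (min_poly K x)"
  using CC.dimI[OF assms(1) dimension_adjoin[OF assms]] by (simp add: over_def)


lemma number_fieldD:
  assumes "number_field F"
  shows "subfield F CC" "x \<in> F \<Longrightarrow> algebraic x" "x \<in> F \<Longrightarrow> alg_over \<rat> x" "\<rat> \<subseteq> F"
  using assms Rats_subset_subfield[of F]
  by (auto simp: number_field_def algebraic_iff_alg_over_Rats[symmetric])

lemma number_field_subfield:
  assumes L: "number_field L" and F: "subfield F CC" "F \<subseteq> L"
  shows "number_field F"
proof -
  obtain N where N: "ring.dimension CC N \<rat> L"
    using L by (auto simp: number_field_def CC.finite_dimension_def)
  have alg: "alg_over \<rat> x" if "x \<in> F" for x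
    using that F number_fieldD(3)[OF L] by blast
  have bound: "Polynomial.degree (min_poly \<rat> x) \<le> N" if "x \<in> F" for x
  proof (rule dimension_mono(1)[OF subfield_Rats _ N])
    show "ring.dimension CC (Polynomial.degree (min_poly \<rat> x)) \<rat> (adjoin \<rat> x)"
      by (rule dimension_adjoin[OF subfield_Rats alg[OF that]])
    show "adjoin \<rat> x \<subseteq> L"
      using adjoin_least[OF F(1) Rats_subset_subfield[OF F(1)] that] F(2) by simp
  qed
  obtain k where "k \<in> F" "F = adjoin \<rat> k"
    by (rule primitive_element[OF subfield_Rats F(1) Rats_subset_subfield[OF F(1)] alg bound])
  then show ?thesis
    using number_field_adjoin[of k] alg[of k] by (simp add: algebraic_iff_alg_over_Rats)
qed

section \<open>Splitting fields\<close>

lemma subfield_generate_field: "subfield (generate_field CC S) CC"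
  by (rule field.generate_field_is_subfield[OF field_CC]) simp

lemma generate_field_least: "subfield E CC \<Longrightarrow> S \<subseteq> E \<Longrightarrow> generate_field CC S \<subseteq> E"
  by (rule field.generate_field_min_subfield1[OF field_CC]) simp

lemma generate_field_incl: "S \<subseteq> generate_field CC S"
  by (rule subsetI) (rule generate_field.incl)

lemma generate_field_algebraic_eq_adjoin:
  assumes "finite S" "\<And>s. s \<in> S \<Longrightarrow> algebraic s"
  shows "\<exists>x. algebraic x \<and> generate_field CC (\<rat> \<union> S) = adjoin \<rat> x"
  using assms
proof (induction S)
  case empty
  have "generate_field CC \<rat> = \<rat>"
    using generate_field_least[OF subfield_Rats order_refl] generate_field_incl[of \<rat>]
    by (rule antisym)
  moreover have "adjoin \<rat> 0 = \<rat>"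
    using adjoin_least[OF subfield_Rats order_refl, of 0] adjoin_incl[of \<rat> 0]
    by (intro antisym) simp_all
  ultimately show ?case by (intro exI[of _ 0]) simp
next
  case (insert s S)
  then obtain x where x: "algebraic x" "generate_field CC (\<rat> \<union> S) = adjoin \<rat> x" by auto
  have s: "algebraic s" using insert by simp
  obtain n where n: "alg_over \<rat> (x + of_nat n * s)" "x \<in> adjoin \<rat> (x + of_nat n * s)"
      "s \<in> adjoin \<rat> (x + of_nat n * s)"
    by (rule primitive_element_two_generators[OF subfield_Rats x(1)[unfolded algebraic_iff_alg_over_Rats]
          s[unfolded algebraic_iff_alg_over_Rats]])
  define c where "c = x + of_nat n * s"
  note n = n[folded c_def]
  let ?E = "generate_field CC (\<rat> \<union> insert s S)"
  have "?E \<subseteq> adjoin \<rat> c"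
  proof (rule generate_field_least[OF subfield_adjoin[OF subfield_Rats n(1)]])
    have "S \<subseteq> adjoin \<rat> x"
      unfolding x(2)[symmetric] using generate_field_incl[of "\<rat> \<union> S"] by blast
    also have "\<dots> \<subseteq> adjoin \<rat> c"
      by (rule adjoin_least[OF subfield_adjoin[OF subfield_Rats n(1)] adjoin_incl n(2)])
    finally show "\<rat> \<union> insert s S \<subseteq> adjoin \<rat> c"
      using n(3) adjoin_incl[of \<rat> c] by blast
  qed
  moreover have "adjoin \<rat> c \<subseteq> ?E"
  proof (rule adjoin_least[OF subfield_generate_field])
    have sub: "\<rat> \<union> insert s S \<subseteq> ?E" by (rule generate_field_incl)
    then show "\<rat> \<subseteq> ?E" by simp
    have "generate_field CC (\<rat> \<union> S) \<subseteq> ?E"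
      by (rule generate_field_least[OF subfield_generate_field]) (use sub in simp)
    then have "x \<in> ?E" using adjoin_mem[OF subfield_Rats, of x] unfolding x(2) by (rule subsetD)
    moreover have "s \<in> ?E" using sub by simp
    ultimately show "c \<in> ?E"
      unfolding c_def using subfield_of_nat[OF subfield_generate_field]
      by (intro subfield_CCD(3,4)[OF subfield_generate_field])
  qed
  ultimately show ?case
    using n(1) by (intro exI[of _ c]) (auto simp: algebraic_iff_alg_over_Rats)
qed

lemma rat_poly_over_Rats: "map_poly of_rat g \<in> polys_over \<rat>"
  by (simp add: polys_over_def coeff_map_poly)

lemma map_poly_of_rat_eq_0: "map_poly of_rat g = (0 :: complex poly) \<longleftrightarrow> g = 0"
  by (simp add: map_poly_eq_0_iff)

lemma finite_complex_roots: "g \<noteq> 0 \<Longrightarrow> finite (complex_roots g)"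
  unfolding complex_roots_def by (rule poly_roots_finite) (simp add: map_poly_of_rat_eq_0)

lemma algebraic_complex_roots: "g \<noteq> 0 \<Longrightarrow> x \<in> complex_roots g \<Longrightarrow> algebraic x"
  by (rule algebraicI'[of "map_poly of_rat g"])
    (auto simp: complex_roots_def map_poly_of_rat_eq_0 coeff_map_poly)

lemma splitting_field_eq_adjoin:
  assumes "g \<noteq> 0"
  obtains t where "algebraic t" "splitting_field g = adjoin \<rat> t"
proof -
  have "\<exists>t. algebraic t \<and> splitting_field g = adjoin \<rat> t"
    unfolding splitting_field_def
    by (rule generate_field_algebraic_eq_adjoin[OF finite_complex_roots[OF assms] algebraic_complex_roots[OF assms]])
  then show ?thesis using that by (elim exE conjE)
qed

lemma number_field_splitting_field: "g \<noteq> 0 \<Longrightarrow> number_field (splitting_field g)"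
  by (erule splitting_field_eq_adjoin) (simp add: number_field_adjoin)

lemma complex_roots_subset_splitting_field: "complex_roots g \<subseteq> splitting_field g"
  unfolding splitting_field_def by (auto intro: generate_field.incl)

lemma splitting_field_least:
  "subfield E CC \<Longrightarrow> complex_roots g \<subseteq> E \<Longrightarrow> splitting_field g \<subseteq> E"
  unfolding splitting_field_def
  using Rats_subset_subfield[of E] by (intro generate_field_least) auto

section \<open>Automorphism groups\<close>

text \<open>
  The automorphisms of the field \<open>L\<close> that fix \<open>K\<close> pointwise, extended to the complex numbers by the
  default value \<^const>\<open>undefined\<close> outside \<open>L\<close>. This is the carrier of the Galois group, spelled out
  in terms of the arithmetic of complex numbers. For \<open>\<rat> \<subseteq> K\<close> it is also the pointwise stabiliser of
  \<open>K\<close> in the automorphism group of \<open>L\<close>.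
\<close>

definition field_autos :: "complex set \<Rightarrow> complex set \<Rightarrow> (complex \<Rightarrow> complex) set" where
  "field_autos L K = {\<sigma> \<in> extensional L. bij_betw \<sigma> L L \<and>
      (\<forall>x\<in>L. \<forall>y\<in>L. \<sigma> (x + y) = \<sigma> x + \<sigma> y \<and> \<sigma> (x * y) = \<sigma> x * \<sigma> y) \<and> \<sigma> 1 = 1 \<and> (\<forall>x\<in>K. \<sigma> x = x)}"

lemma carrier_galois_group: "carrier (galois_group L K) = field_autos L K"
  by (auto simp: galois_group_def field_autos_def Bij_def ring_hom_def bij_betw_def)

lemma mult_galois_group:
  "\<sigma> \<in> field_autos L K \<Longrightarrow> \<tau> \<in> field_autos L K \<Longrightarrow> \<sigma> \<otimes>\<^bsub>galois_group L K\<^esub> \<tau> = compose L \<sigma> \<tau>"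
  by (simp add: galois_group_def BijGroup_def field_autos_def Bij_def)

lemma one_galois_group: "\<one>\<^bsub>galois_group L K\<^esub> = (\<lambda>x\<in>L. x)"
  by (simp add: galois_group_def BijGroup_def)

lemma field_autosD:
  assumes "\<sigma> \<in> field_autos L K"
  shows "x \<in> L \<Longrightarrow> \<sigma> x \<in> L" "\<sigma> ` L = L" "inj_on \<sigma> L" "\<sigma> \<in> extensional L"
    "x \<in> L \<Longrightarrow> y \<in> L \<Longrightarrow> \<sigma> (x + y) = \<sigma> x + \<sigma> y"
    "x \<in> L \<Longrightarrow> y \<in> L \<Longrightarrow> \<sigma> (x * y) = \<sigma> x * \<sigma> y"
    "\<sigma> 1 = 1" "x \<in> K \<Longrightarrow> \<sigma> x = x"
  using assms by (auto simp: field_autos_def bij_betw_def)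

lemma field_autos_arith:
  assumes L: "subfield L CC" and s: "\<sigma> \<in> field_autos L K"
  shows "\<sigma> 0 = 0" "x \<in> L \<Longrightarrow> \<sigma> (- x) = - \<sigma> x" "x \<in> L \<Longrightarrow> \<sigma> (inverse x) = inverse (\<sigma> x)"
proof -
  note D = field_autosD[OF s] and S = subfield_CCD[OF L]
  show 0: "\<sigma> 0 = 0" using D(5)[of 0 0] S(1) by simp
  show "\<sigma> (- x) = - \<sigma> x" if "x \<in> L"
    using D(5)[OF that S(5)[OF that]] 0 by (simp add: eq_neg_iff_add_eq_0 add.commute)
  show "\<sigma> (inverse x) = inverse (\<sigma> x)" if "x \<in> L"
  proof (cases "x = 0")
    case False
    then have "\<sigma> x * \<sigma> (inverse x) = 1"
      using D(6)[OF that S(7)[OF that]] D(7) by simp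
    then show ?thesis by (metis inverse_unique)
  qed (simp add: 0)
qed


lemma group_galois_group:
  assumes L: "subfield L CC" and KL: "K \<subseteq> L"
  shows "group (galois_group L K)"
proof -
  have "subgroup (field_autos L K) (BijGroup L)"
  proof (rule group.subgroupI[OF group_BijGroup])
    show "field_autos L K \<subseteq> carrier (BijGroup L)"
      by (auto simp: BijGroup_def Bij_def field_autos_def)
    have "(\<lambda>x\<in>L. x) \<in> field_autos L K"
      using id_Bij[of L] subfield_CCD[OF L] KL by (auto simp: field_autos_def Bij_def)
    then show "field_autos L K \<noteq> {}" by blast
  next
    fix s assume s: "s \<in> field_autos L K"
    note D = field_autosD[OF s]
    have sB: "s \<in> Bij L" using s by (simp add: field_autos_def Bij_def)
    let ?t = "\<lambda>x\<in>L. inv_into L s x"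
    have inv_mem: "inv_into L s x \<in> L" if "x \<in> L" for x
      using that D(2) by (metis inv_into_into)
    have s_inv: "s (inv_into L s x) = x" if "x \<in> L" for x
      using that D(2) by (metis f_inv_into_f)
    have inv_s: "inv_into L s (s x) = x" if "x \<in> L" for x
      by (rule inv_into_f_f[OF D(3) that])
    note S = subfield_CCD[OF L]
    have "?t \<in> field_autos L K"
      unfolding field_autos_def
    proof (intro CollectI conjI ballI)
      show "?t \<in> extensional L" by simp
      show "bij_betw ?t L L"
        using restrict_inv_into_Bij[OF sB] by (simp add: Bij_def)
      fix x y assume xy: "x \<in> L" "y \<in> L"
      have "inv_into L s (x + y) = inv_into L s x + inv_into L s y"
        using D(5)[OF inv_mem[OF xy(1)] inv_mem[OF xy(2)]] s_inv xy
          inv_s[OF S(3)[OF inv_mem[OF xy(1)] inv_mem[OF xy(2)]]] by simp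
      then show "?t (x + y) = ?t x + ?t y" using xy S(3)[OF xy] by simp
      have "inv_into L s (x * y) = inv_into L s x * inv_into L s y"
        using D(6)[OF inv_mem[OF xy(1)] inv_mem[OF xy(2)]] s_inv xy
          inv_s[OF S(4)[OF inv_mem[OF xy(1)] inv_mem[OF xy(2)]]] by simp
      then show "?t (x * y) = ?t x * ?t y" using xy S(4)[OF xy] by simp
    next
      show "?t 1 = 1" using inv_s[OF S(2)] D(7) S(2) by simp
      fix x assume "x \<in> K"
      then show "?t x = x" using inv_s[of x] D(8)[of x] KL by auto
    qed
    then show "inv\<^bsub>BijGroup L\<^esub> s \<in> field_autos L K"
      by (simp add: inv_BijGroup[OF sB])
  next
    fix s t assume s: "s \<in> field_autos L K" and t: "t \<in> field_autos L K"
    then have B: "s \<in> Bij L" "t \<in> Bij L" by (simp_all add: field_autos_def Bij_def)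
    have "compose L s t \<in> field_autos L K"
      unfolding field_autos_def
    proof (intro CollectI conjI ballI)
      show "compose L s t \<in> extensional L" "bij_betw (compose L s t) L L"
        using compose_Bij[OF B] by (simp_all add: Bij_def)
      show "compose L s t 1 = 1"
        using subfield_CCD(2)[OF L] field_autosD(7)[OF s] field_autosD(7)[OF t] by (simp add: compose_def)
      show "compose L s t x = x" if "x \<in> K" for x
        using that KL field_autosD(8)[OF s that] field_autosD(8)[OF t that] by (auto simp: compose_def)
      fix x y assume xy: "x \<in> L" "y \<in> L"
      note m = field_autosD(1)[OF t xy(1)] field_autosD(1)[OF t xy(2)]
      show "compose L s t (x + y) = compose L s t x + compose L s t y"
        using xy subfield_CCD(3)[OF L xy] field_autosD(5)[OF t xy] field_autosD(5)[OF s m]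
        by (simp add: compose_def)
      show "compose L s t (x * y) = compose L s t x * compose L s t y"
        using xy subfield_CCD(4)[OF L xy] field_autosD(6)[OF t xy] field_autosD(6)[OF s m]
        by (simp add: compose_def)
    qed
    then show "s \<otimes>\<^bsub>BijGroup L\<^esub> t \<in> field_autos L K"
      using B by (simp add: BijGroup_def)
  qed
  then have "group (BijGroup L\<lparr>carrier := field_autos L K\<rparr>)"
    by (rule subgroup.subgroup_is_group) (rule group_BijGroup)
  moreover have "galois_group L K = BijGroup L\<lparr>carrier := field_autos L K\<rparr>"
    using carrier_galois_group[of L K] by (simp add: galois_group_def)
  ultimately show ?thesis by simp
qed

lemma galois_group_apply:
  assumes L: "subfield L CC" "K \<subseteq> L"
  shows mult_galois_apply: "\<sigma> \<in> field_autos L K \<Longrightarrow> \<tau> \<in> field_autos L K \<Longrightarrow> x \<in> L \<Longrightarrow>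
      (\<sigma> \<otimes>\<^bsub>galois_group L K\<^esub> \<tau>) x = \<sigma> (\<tau> x)"
    and inv_galois_apply: "\<sigma> \<in> field_autos L K \<Longrightarrow> x \<in> L \<Longrightarrow> (inv\<^bsub>galois_group L K\<^esub> \<sigma>) (\<sigma> x) = x"
proof -
  show *: "(\<sigma> \<otimes>\<^bsub>galois_group L K\<^esub> \<tau>) x = \<sigma> (\<tau> x)"
    if "\<sigma> \<in> field_autos L K" "\<tau> \<in> field_autos L K" "x \<in> L" for \<sigma> \<tau> x
    using that by (simp add: mult_galois_group compose_def)
  interpret G: group "galois_group L K" by (rule group_galois_group[OF L])
  show "(inv\<^bsub>galois_group L K\<^esub> \<sigma>) (\<sigma> x) = x" if s: "\<sigma> \<in> field_autos L K" and x: "x \<in> L"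
  proof -
    have s': "\<sigma> \<in> carrier (galois_group L K)" using s by (simp add: carrier_galois_group)
    have "(inv\<^bsub>galois_group L K\<^esub> \<sigma>) (\<sigma> x) = (inv\<^bsub>galois_group L K\<^esub> \<sigma> \<otimes>\<^bsub>galois_group L K\<^esub> \<sigma>) x"
      using *[OF _ s x] G.inv_closed[OF s'] by (simp add: carrier_galois_group)
    then show ?thesis using G.l_inv[OF s'] x by (simp add: one_galois_group)
  qed
qed

lemma field_autos_eqI:
  assumes "\<sigma> \<in> field_autos L K" "\<tau> \<in> field_autos L K" "\<And>x. x \<in> L \<Longrightarrow> \<sigma> x = \<tau> x"
  shows "\<sigma> = \<tau>"
  using assms field_autosD(4) by (metis extensionalityI)

text \<open>An automorphism commutes with polynomials whose coefficients it fixes.\<close>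

lemma field_autos_poly:
  assumes L: "subfield L CC" and s: "\<sigma> \<in> field_autos L \<rat>"
    and p: "p \<in> polys_over F" and F: "F \<subseteq> L" "\<And>a. a \<in> F \<Longrightarrow> \<sigma> a = a" and x: "x \<in> L"
  shows "\<sigma> (poly p x) = poly p (\<sigma> x)"
proof -
  have "\<forall>i. Polynomial.coeff p i \<in> F" using p by (simp add: polys_over_def)
  then have "\<sigma> (poly p x) = poly p (\<sigma> x) \<and> poly p x \<in> L"
  proof (induction p)
    case 0
    then show ?case using field_autos_arith(1)[OF L s] subfield_CCD(1)[OF L] by simp
  next
    case (pCons a p)
    have "Polynomial.coeff (pCons a p) 0 \<in> F" "\<forall>i. Polynomial.coeff (pCons a p) (Suc i) \<in> F"
      using pCons.prems by blast+
    then have a: "a \<in> F" and IH: "\<sigma> (poly p x) = poly p (\<sigma> x)" "poly p x \<in> L"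
      using pCons.IH by simp_all
    have aL: "a \<in> L" using a F(1) by blast
    show ?case
      using field_autosD(5)[OF s aL subfield_CCD(4)[OF L x IH(2)]] field_autosD(6)[OF s x IH(2)] IH F(2)[OF a]
        subfield_CCD(3)[OF L aL subfield_CCD(4)[OF L x IH(2)]]
      by simp
  qed
  then show ?thesis ..
qed

lemma field_autos_poly_Rats:
  assumes "subfield L CC" "\<sigma> \<in> field_autos L \<rat>" "p \<in> polys_over \<rat>" "x \<in> L"
  shows "\<sigma> (poly p x) = poly p (\<sigma> x)"
  using assms Rats_subset_subfield[OF assms(1)] field_autosD(8)[OF assms(2)]
  by (intro field_autos_poly[where F = \<rat>])

text \<open>
  Applying an automorphism to the coefficients of a product of linear factors applies it to the
  roots.
\<close>

lemma coeff_root_prod_automorphism: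
  assumes L: "subfield L CC" and s: "\<sigma> \<in> field_autos L \<rat>" and "finite A" "A \<subseteq> L"
  shows "Polynomial.coeff (\<Prod>x\<in>A. [:- x, 1:]) i \<in> L \<and>
    \<sigma> (Polynomial.coeff (\<Prod>x\<in>A. [:- x, 1:]) i) = Polynomial.coeff (\<Prod>x\<in>A. [:- \<sigma> x, 1:]) i"
  using assms(3,4)
proof (induction A arbitrary: i)
  case empty
  then show ?case
    using subfield_CCD(1,2)[OF L] field_autos_arith(1)[OF L s] field_autosD(7)[OF s]
    by (simp add: coeff_pCons split: nat.splits)
next
  case (insert a A)
  define P where "P = (\<Prod>x\<in>A. [:- x, 1:])"
  define Q where "Q = (\<Prod>x\<in>A. [:- \<sigma> x, 1:])"
  have IH: "Polynomial.coeff P j \<in> L" "\<sigma> (Polynomial.coeff P j) = Polynomial.coeff Q j" for j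
    using insert unfolding P_def Q_def by simp_all
  have a: "a \<in> L" using insert by simp
  note S = subfield_CCD[OF L] and D = field_autosD[OF s] and E = field_autos_arith[OF L s]
  have c: "Polynomial.coeff ([:- b, 1:] * R) i = - b * Polynomial.coeff R i + (case i of 0 \<Rightarrow> 0 | Suc j \<Rightarrow> Polynomial.coeff R j)"
    for b :: complex and R
    by (simp add: coeff_pCons split: nat.splits)
  have 1: "- a * Polynomial.coeff P i \<in> L" "\<sigma> (- a * Polynomial.coeff P i) = - \<sigma> a * Polynomial.coeff Q i"
    using S(4)[OF S(5)[OF a] IH(1)] D(6)[OF S(5)[OF a] IH(1)] E(2)[OF a] IH(2) by simp_all
  have 2: "(case i of 0 \<Rightarrow> 0 | Suc j \<Rightarrow> Polynomial.coeff P j) \<in> L"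
    "\<sigma> (case i of 0 \<Rightarrow> 0 | Suc j \<Rightarrow> Polynomial.coeff P j) = (case i of 0 \<Rightarrow> 0 | Suc j \<Rightarrow> Polynomial.coeff Q j)"
    using S(1) E(1) IH by (simp_all split: nat.splits)
  have "(\<Prod>x\<in>insert a A. [:- x, 1:]) = [:- a, 1:] * P"
    "(\<Prod>x\<in>insert a A. [:- \<sigma> x, 1:]) = [:- \<sigma> a, 1:] * Q"
    unfolding P_def Q_def by (rule prod.insert[OF insert(1,2)])+
  then show ?case
    using S(3)[OF 1(1) 2(1)] D(5)[OF 1(1) 2(1)] by (simp only: c 1(2) 2(2))
qed

text \<open>The elements of \<open>L\<close> that are fixed by all maps in \<open>H\<close>.\<close>

definition fixed_field :: "complex set \<Rightarrow> (complex \<Rightarrow> complex) set \<Rightarrow> complex set" where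
  "fixed_field L H = {x \<in> L. \<forall>\<sigma>\<in>H. \<sigma> x = x}"

lemma subfield_fixed_field:
  assumes L: "subfield L CC" and H: "H \<subseteq> field_autos L \<rat>"
  shows "subfield (fixed_field L H) CC"
proof (rule subfield_CCI)
  note S = subfield_CCD[OF L]
  have D: "s \<in> field_autos L \<rat>" if "s \<in> H" for s using that H by blast
  show "0 \<in> fixed_field L H" "1 \<in> fixed_field L H"
    using S(1,2) field_autos_arith(1)[OF L D] field_autosD(7)[OF D] by (simp_all add: fixed_field_def)
  show "- x \<in> fixed_field L H" "inverse x \<in> fixed_field L H" if "x \<in> fixed_field L H" for x
  proof -
    have x: "x \<in> L" and fx: "\<sigma> x = x" if "\<sigma> \<in> H" for \<sigma>
      using \<open>x \<in> fixed_field L H\<close> that by (simp_all add: fixed_field_def)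
    have "\<sigma> (- x) = - x \<and> \<sigma> (inverse x) = inverse x" if "\<sigma> \<in> H" for \<sigma>
      using field_autos_arith(2,3)[OF L D[OF that] x[OF that]] fx[OF that] by simp
    then show "- x \<in> fixed_field L H" "inverse x \<in> fixed_field L H"
      using \<open>x \<in> fixed_field L H\<close> S(5,7)[of x] by (simp_all add: fixed_field_def)
  qed
  show "x + y \<in> fixed_field L H" "x * y \<in> fixed_field L H"
    if xy: "x \<in> fixed_field L H" "y \<in> fixed_field L H" for x y
  proof -
    have m: "x \<in> L" "y \<in> L" using xy by (simp_all add: fixed_field_def)
    have "\<sigma> (x + y) = x + y \<and> \<sigma> (x * y) = x * y" if "\<sigma> \<in> H" for \<sigma>
    proof -
      have "\<sigma> x = x" "\<sigma> y = y" using xy that unfolding fixed_field_def by blast+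
      then show ?thesis using field_autosD(5,6)[OF D[OF that] m] by simp
    qed
    then show "x + y \<in> fixed_field L H" "x * y \<in> fixed_field L H"
      using S(3,4)[OF m] by (simp_all add: fixed_field_def)
  qed
qed

text \<open>A monic polynomial whose set of roots is stable under \<open>H\<close> has coefficients fixed by \<open>H\<close>.\<close>

lemma root_prod_over_fixed_field:
  assumes L: "subfield L CC" and H: "H \<subseteq> field_autos L \<rat>"
    and A: "finite A" "A \<subseteq> L" "\<And>\<sigma>. \<sigma> \<in> H \<Longrightarrow> \<sigma> ` A \<subseteq> A"
  shows "(\<Prod>x\<in>A. [:- x, 1:]) \<in> polys_over (fixed_field L H)"
proof -
  have id: "(\<lambda>x\<in>L. x) \<in> field_autos L \<rat>"
    using monoid.one_closed[OF group.is_monoid[OF group_galois_group[OF L Rats_subset_subfield[OF L]]]]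
    unfolding one_galois_group carrier_galois_group .
  have "\<sigma> (Polynomial.coeff (\<Prod>x\<in>A. [:- x, 1:]) i) = Polynomial.coeff (\<Prod>x\<in>A. [:- x, 1:]) i"
    if s: "\<sigma> \<in> H" for \<sigma> i
  proof -
    have s': "\<sigma> \<in> field_autos L \<rat>" using s H by blast
    have inj: "inj_on \<sigma> A" using inj_on_subset[OF field_autosD(3)[OF s'] A(2)] .
    then have "\<sigma> ` A = A" using endo_inj_surj[OF A(1) A(3)[OF s]] by simp
    then have "(\<Prod>x\<in>A. [:- \<sigma> x, 1:]) = (\<Prod>x\<in>A. [:- x, 1:])"
      using prod.reindex[OF inj, of "\<lambda>x. [:- x, 1:]"] by simp
    then show ?thesis
      using coeff_root_prod_automorphism[OF L s' A(1,2), of i] by simp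
  qed
  moreover have "Polynomial.coeff (\<Prod>x\<in>A. [:- x, 1:]) i \<in> L" for i
    using coeff_root_prod_automorphism[OF L id A(1,2), of i] by simp
  ultimately show ?thesis by (simp add: polys_over_def fixed_field_def)
qed

section \<open>Normality of splitting fields\<close>

lemma polys_over_diff: "subfield K CC \<Longrightarrow> p \<in> polys_over K \<Longrightarrow> q \<in> polys_over K \<Longrightarrow> p - q \<in> polys_over K"
  by (simp add: polys_over_def subfield_CCD)

text \<open>
  The map \<open>p(x) \<mapsto> p(t)\<close> is well defined on \<open>K(x)\<close> if \<open>t\<close> is a conjugate of \<open>x\<close>, because the minimal
  polynomial of \<open>x\<close> divides every difference of two polynomials with the same value at \<open>x\<close>.
\<close>

lemma adjoin_hom_exists:
  assumes K: "subfield K CC" and x: "alg_over K x" and t: "poly (min_poly K x) t = 0"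
  shows "\<exists>s. \<forall>p\<in>polys_over K. s (poly p x) = poly p t"
proof (intro exI ballI)
  fix p assume p: "p \<in> polys_over K"
  define q where "q = (SOME q. q \<in> polys_over K \<and> poly q x = poly p x)"
  have q: "q \<in> polys_over K \<and> poly q x = poly p x"
    unfolding q_def by (rule someI[of _ p]) (simp add: p)
  have "min_poly K x dvd q - p"
    using q p by (intro min_poly_dvd[OF K x] polys_over_diff[OF K]) auto
  then have "poly (q - p) t = 0" using t by (rule poly_root_dvd_mono)
  then show "(\<lambda>y. poly (SOME q. q \<in> polys_over K \<and> poly q x = y) t) (poly p x) = poly p t"
    by (simp add: q_def)
qed

text \<open>
  The homomorphism that sends the primitive element \<open>x\<close> to its conjugate \<open>t\<close> permutes the roots of
  \<open>g\<close>. So its image \<open>\<rat>(t)\<close> contains them and hence \<open>L\<close>; by equality of degrees it is \<open>L\<close>.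
\<close>

lemma splitting_field_automorphism_exists:
  assumes g: "g \<noteq> 0" and L: "L = splitting_field g" and x: "L = adjoin \<rat> x" "alg_over \<rat> x"
    and t: "poly (min_poly \<rat> x) t = 0"
  obtains \<sigma> where "\<sigma> \<in> field_autos L \<rat>" "\<sigma> x = t"
proof -
  obtain s where s: "\<And>p. p \<in> polys_over \<rat> \<Longrightarrow> s (poly p x) = poly p t"
    using adjoin_hom_exists[OF subfield_Rats x(2) t] by auto
  note t' = min_poly_conjugate[OF subfield_Rats x(2) t]
  have Limg: "L = (\<lambda>p. poly p x) ` polys_over \<rat>"
    unfolding x(1) by (rule adjoin_eq_polys[OF subfield_Rats])
  have Lpoly: "\<exists>p\<in>polys_over \<rat>. y = poly p x" if "y \<in> L" for y
    using that unfolding Limg by (elim imageE) (rule bexI)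
  have simg: "s ` L = adjoin \<rat> t"
    unfolding Limg adjoin_eq_polys[OF subfield_Rats] image_image
    by (rule image_cong) (simp_all add: s)
  have sF: "subfield L CC" unfolding x(1) by (rule subfield_adjoin[OF subfield_Rats x(2)])
  have X: "[:0, 1:] \<in> polys_over \<rat>" by (simp add: subfield_Rats polys_over_0)
  have C: "[:c:] \<in> polys_over \<rat>" if "c \<in> \<rat>" for c using that by (simp add: subfield_Rats polys_over_0)
  have sx: "s x = t" using s[OF X] by simp
  have sc: "s c = c" if "c \<in> \<rat>" for c using s[OF C[OF that]] by simp
  have hom: "s (y + z) = s y + s z \<and> s (y * z) = s y * s z" if yz: "y \<in> L" "z \<in> L" for y z
  proof -
    obtain p q where pq: "p \<in> polys_over \<rat>" "y = poly p x" "q \<in> polys_over \<rat>" "z = poly q x"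
      using Lpoly[OF yz(1)] Lpoly[OF yz(2)] by metis
    show ?thesis
      using s[OF polys_over_add[OF subfield_Rats pq(1,3)]] s[OF polys_over_mult[OF subfield_Rats pq(1,3)]]
        s[OF pq(1)] s[OF pq(3)] by (simp add: pq(2,4))
  qed
  have inj: "inj_on s L"
  proof (rule inj_onI)
    fix y z assume yz: "y \<in> L" "z \<in> L" "s y = s z"
    obtain p q where pq: "p \<in> polys_over \<rat>" "y = poly p x" "q \<in> polys_over \<rat>" "z = poly q x"
      using Lpoly[OF yz(1)] Lpoly[OF yz(2)] by metis
    have "min_poly \<rat> x dvd p - q"
      using min_poly_dvd[OF subfield_Rats t'(1) polys_over_diff[OF subfield_Rats pq(1,3)]]
        yz(3) s[OF pq(1)] s[OF pq(3)] by (simp add: pq(2,4) t'(2))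
    then have "poly (p - q) x = 0"
      using min_poly_root[OF subfield_Rats x(2)] by (rule poly_root_dvd_mono)
    then show "y = z" by (simp add: pq)
  qed
  have RL: "complex_roots g \<subseteq> L" unfolding L by (rule complex_roots_subset_splitting_field)
  have "s ` complex_roots g \<subseteq> complex_roots g"
  proof (rule image_subsetI)
    fix r assume r: "r \<in> complex_roots g"
    obtain p where p: "p \<in> polys_over \<rat>" "r = poly p x"
      using Lpoly[OF subsetD[OF RL r]] by metis
    have "s (poly (pcompose (map_poly of_rat g) p) x) = poly (pcompose (map_poly of_rat g) p) t"
      by (rule s[OF polys_over_pcompose[OF subfield_Rats rat_poly_over_Rats p(1)]])
    then have "s (poly (map_poly of_rat g) r) = poly (map_poly of_rat g) (s r)"
      using s[OF p(1)] by (simp add: poly_pcompose p(2))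
    then show "s r \<in> complex_roots g"
      using r sc[of 0] by (simp add: complex_roots_def)
  qed
  then have "s ` complex_roots g = complex_roots g"
    by (rule endo_inj_surj[OF finite_complex_roots[OF g] _ inj_on_subset[OF inj RL]])
  then have "complex_roots g \<subseteq> adjoin \<rat> t"
    using image_mono[OF RL, of s] simg by simp
  then have "L \<subseteq> adjoin \<rat> t"
    unfolding L by (rule splitting_field_least[OF subfield_adjoin[OF subfield_Rats t'(1)]])
  then have "L = adjoin \<rat> t"
    using dimension_mono(2)[OF subfield_Rats dimension_adjoin[OF subfield_Rats x(2)]
      dimension_adjoin[OF subfield_Rats t'(1)]] t'(2) unfolding x(1) by simp
  then have "s ` L = L" using simg by (rule trans[OF _ sym, rotated])
  then have bij: "bij_betw (restrict s L) L L"
    using inj by (simp add: bij_betw_def inj_on_restrict_eq)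
  have "restrict s L \<in> field_autos L \<rat>"
    unfolding field_autos_def
  proof (intro CollectI conjI ballI bij)
    note S = subfield_CCD[OF sF]
    show "restrict s L \<in> extensional L" by simp
    show "restrict s L 1 = 1" using S(2) sc[of 1] by simp
    show "restrict s L c = c" if "c \<in> \<rat>" for c
      using sc[OF that] that Rats_subset_subfield[OF sF] by auto
    show "restrict s L (y + z) = restrict s L y + restrict s L z"
      "restrict s L (y * z) = restrict s L y * restrict s L z" if "y \<in> L" "z \<in> L" for y z
      using that S(3,4)[OF that] hom[OF that] by simp_all
  qed
  moreover have "x \<in> L" unfolding x(1) by (rule adjoin_mem[OF subfield_Rats])
  then have "restrict s L x = t" using sx by simp
  ultimately show ?thesis by (rule that)
qed

text \<open>
  A fixed element \<open>x = p(t)\<close>, with \<open>p\<close> of smaller degree than the minimal polynomial of the primitive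
  element \<open>t\<close>, satisfies \<open>p(r) = x\<close> for all conjugates \<open>r\<close> of \<open>t\<close>. So \<open>p\<close> is the constant \<open>x\<close>, as
  otherwise \<open>p - x\<close> would have more roots than its degree allows.
\<close>

lemma galois_fixed_field_Rats:
  assumes g: "g \<noteq> 0" and L: "L = splitting_field g"
  shows "fixed_field L (field_autos L \<rat>) = \<rat>"
proof
  obtain t where t: "algebraic t" "splitting_field g = adjoin \<rat> t"
    by (rule splitting_field_eq_adjoin[OF g])
  have alg: "alg_over \<rat> t" using t(1) by (simp add: algebraic_iff_alg_over_Rats)
  have Lt: "L = adjoin \<rat> t" using t(2) L by simp
  have sF: "subfield L CC" unfolding Lt by (rule subfield_adjoin[OF subfield_Rats alg])
  have tL: "t \<in> L" unfolding Lt by (rule adjoin_mem[OF subfield_Rats])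
  show "fixed_field L (field_autos L \<rat>) \<subseteq> \<rat>"
  proof
    fix x assume x: "x \<in> fixed_field L (field_autos L \<rat>)"
    then have "x \<in> adjoin \<rat> t" by (simp add: fixed_field_def Lt)
    then obtain p where p: "p \<in> polys_over \<rat>" "Polynomial.degree p < Polynomial.degree (min_poly \<rat> t)"
        "x = poly p t"
      using adjoin_low_degree[OF subfield_Rats alg, of x] by auto
    have roots: "poly (p - [:x:]) r = 0" if r: "poly (min_poly \<rat> t) r = 0" for r
    proof -
      obtain \<sigma> where \<sigma>: "\<sigma> \<in> field_autos L \<rat>" "\<sigma> t = r"
        by (rule splitting_field_automorphism_exists[OF g L Lt alg r])
      have "\<sigma> x = poly p r"
        using field_autos_poly_Rats[OF sF \<sigma>(1) p(1) tL] by (simp add: p(3) \<sigma>(2))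
      moreover have "\<sigma> x = x" using x \<sigma>(1) by (simp add: fixed_field_def)
      ultimately show ?thesis by simp
    qed
    have "p - [:x:] = 0"
    proof (rule ccontr)
      assume ne: "p - [:x:] \<noteq> 0"
      have "Polynomial.degree (min_poly \<rat> t) = card {z. poly (min_poly \<rat> t) z = 0}"
        by (rule card_roots_rsquarefree[OF rsquarefree_min_poly[OF subfield_Rats alg], symmetric])
      also have "\<dots> \<le> card {z. poly (p - [:x:]) z = 0}"
        using roots by (intro card_mono poly_roots_finite[OF ne]) auto
      also have "\<dots> \<le> Polynomial.degree (p - [:x:])"
        by (rule card_poly_roots_bound[OF ne])
      also have "\<dots> \<le> Polynomial.degree p"
        using degree_diff_le_max[of p "[:x:]"] by simp
      finally show False using p(2) by simp
    qed
    then have "Polynomial.coeff p 0 = x" by simp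
    then show "x \<in> \<rat>" using p(1) by (auto simp: polys_over_def)
  qed
  show "\<rat> \<subseteq> fixed_field L (field_autos L \<rat>)"
  proof
    fix c :: complex assume c: "c \<in> \<rat>"
    then have "c \<in> L" using Rats_subset_subfield[OF sF] by blast
    moreover have "\<sigma> c = c" if "\<sigma> \<in> field_autos L \<rat>" for \<sigma>
      by (rule field_autosD(8)[OF that c])
    ultimately show "c \<in> fixed_field L (field_autos L \<rat>)" by (simp add: fixed_field_def)
  qed
qed


section \<open>Costs of chains\<close>

lemma finite_chain_cost: "finite {d (xs ! i) (xs ! Suc i) | i. Suc i < length xs}"
proof -
  have "{d (xs ! i) (xs ! Suc i) | i. Suc i < length xs} \<subseteq> (\<lambda>i. d (xs ! i) (xs ! Suc i)) ` {..<length xs}"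
    by auto
  then show ?thesis by (rule finite_subset) simp
qed

lemma chain_cost_ge:
  assumes "Suc i < length xs"
  shows "d (xs ! i) (xs ! Suc i) \<le> chain_cost d xs"
  using assms unfolding chain_cost_def by (auto intro!: Max_ge finite_chain_cost)

lemma chain_cost_le:
  assumes "1 \<le> k" "\<And>i. Suc i < length xs \<Longrightarrow> d (xs ! i) (xs ! Suc i) \<le> k"
  shows "chain_cost d xs \<le> k"
proof (cases "length xs \<le> 1")
  case False
  then have "d (xs ! 0) (xs ! Suc 0) \<in> {d (xs ! i) (xs ! Suc i) | i. Suc i < length xs}" by auto
  then have "Max {d (xs ! i) (xs ! Suc i) | i. Suc i < length xs} \<le> k"
    using finite_chain_cost[of d xs] assms(2) by (intro Max.boundedI) auto
  then show ?thesis using False by (simp add: chain_cost_def)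
qed (use assms in \<open>simp add: chain_cost_def\<close>)

section \<open>Counting in finite groups\<close>

context group
begin

text \<open>
  A function on \<open>A\<close> that is constant on the left cosets of \<open>B\<close> takes at most \<open>|A| / |B|\<close> values, and
  one that agrees at \<open>s\<close> and \<open>t\<close> only if \<open>s\<^sup>-\<^sup>1 t \<in> B\<close> takes at least \<open>|A| / |B|\<close> values.
\<close>

lemma card_image_mult_card_le:
  assumes A: "subgroup A G" "finite A" and B: "subgroup B G" "B \<subseteq> A"
    and \<phi>: "\<And>s b. s \<in> A \<Longrightarrow> b \<in> B \<Longrightarrow> \<phi> (s \<otimes> b) = \<phi> s"
  shows "card (\<phi> ` A) * card B \<le> card A"
proof -
  define r where "r = inv_into A \<phi>"
  have r: "r y \<in> A" "\<phi> (r y) = y" if "y \<in> \<phi> ` A" for y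
    using that by (simp_all add: r_def inv_into_into f_inv_into_f)
  have AG: "s \<in> carrier G" if "s \<in> A" for s using subgroup.mem_carrier[OF A(1) that] .
  have "inj_on (\<lambda>(y, b). r y \<otimes> b) (\<phi> ` A \<times> B)"
  proof (rule inj_onI, clarify)
    fix s t b c assume *: "s \<in> A" "t \<in> A" "b \<in> B" "c \<in> B" "r (\<phi> s) \<otimes> b = r (\<phi> t) \<otimes> c"
    have m: "r (\<phi> s) \<in> A" "r (\<phi> t) \<in> A" using r(1) *(1,2) by simp_all
    have "\<phi> (r (\<phi> s) \<otimes> b) = \<phi> (r (\<phi> t) \<otimes> c)" using *(5) by simp
    then have "\<phi> s = \<phi> t" using \<phi>[OF m(1) *(3)] \<phi>[OF m(2) *(4)] r(2) *(1,2) by simp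
    moreover have "b = c"
      using *(5) unfolding \<open>\<phi> s = \<phi> t\<close> using AG[OF m(2)] AG subsetD[OF B(2)] *(3,4) l_cancel by blast
    ultimately show "\<phi> s = \<phi> t \<and> b = c" by blast
  qed
  moreover have "(\<lambda>(y, b). r y \<otimes> b) ` (\<phi> ` A \<times> B) \<subseteq> A"
    using r(1) B(2) subgroup.m_closed[OF A(1)] by auto
  ultimately have "card (\<phi> ` A \<times> B) \<le> card A"
    by (rule card_inj_on_le) (rule A(2))
  then show ?thesis by (simp add: card_cartesian_product)
qed

lemma card_le_card_image_mult:
  assumes A: "subgroup A G" "finite A" and B: "finite B"
    and \<phi>: "\<And>s t. s \<in> A \<Longrightarrow> t \<in> A \<Longrightarrow> \<phi> s = \<phi> t \<Longrightarrow> inv s \<otimes> t \<in> B"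
  shows "card A \<le> card (\<phi> ` A) * card B"
proof -
  define r where "r = inv_into A \<phi>"
  have r: "r (\<phi> s) \<in> A" "\<phi> (r (\<phi> s)) = \<phi> s" if "s \<in> A" for s
    using that by (simp_all add: r_def inv_into_into f_inv_into_f)
  have AG: "s \<in> carrier G" if "s \<in> A" for s using subgroup.mem_carrier[OF A(1) that] .
  have "inj_on (\<lambda>s. (\<phi> s, inv (r (\<phi> s)) \<otimes> s)) A"
  proof (rule inj_onI, clarify)
    fix s t assume *: "s \<in> A" "t \<in> A" "\<phi> s = \<phi> t" "inv (r (\<phi> s)) \<otimes> s = inv (r (\<phi> t)) \<otimes> t"
    then have "inv (r (\<phi> t)) \<otimes> s = inv (r (\<phi> t)) \<otimes> t" by simp
    then show "s = t" using AG[OF *(1)] AG[OF *(2)] AG[OF r(1)[OF *(2)]] by simp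
  qed
  moreover have "(\<lambda>s. (\<phi> s, inv (r (\<phi> s)) \<otimes> s)) ` A \<subseteq> \<phi> ` A \<times> B"
    using \<phi>[OF r(1) _ r(2)] by auto
  ultimately have "card A \<le> card (\<phi> ` A \<times> B)"
    by (rule card_inj_on_le) (use A(2) B in simp)
  then show ?thesis by (simp add: card_cartesian_product)
qed

lemma subgroup_index_mult_card:
  assumes H: "subgroup H G" "finite H" and K: "subgroup K G" "K \<subseteq> H"
  shows "subgroup_index G H K * card K = card H"
proof -
  interpret H: group "G\<lparr>carrier := H\<rparr>" by (rule subgroup.subgroup_is_group[OF H(1)]) (rule group_axioms)
  have "subgroup K (G\<lparr>carrier := H\<rparr>)" by (rule subgroup_incl[OF K(1) H(1) K(2)])
  then show ?thesis
    using H.lagrange[of K] by (simp add: subgroup_index_def Coset.order_def mult.commute)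
qed

end

section \<open>Chains of subgroups with bounded indices\<close>

text \<open>
  The subgroup \<open>B\<close> of \<open>A\<close> has index at most \<open>k\<close>. The inclusion need not be strict, and the bound
  is stated without division. The reflexive transitive closure of \<open>index_bounded G k\<close> relates the
  endpoints of the descending chains of subgroups whose successive indices are at most \<open>k\<close>.
\<close>

definition index_bounded :: "('a, 'b) monoid_scheme \<Rightarrow> nat \<Rightarrow> 'a set \<Rightarrow> 'a set \<Rightarrow> bool" where
  "index_bounded G k A B \<longleftrightarrow> subgroup A G \<and> subgroup B G \<and> B \<subseteq> A \<and> card A \<le> k * card B"

context group
begin

lemma card_l_cosets_le:
  assumes fin: "finite (carrier G)" and AB: "index_bounded G k A B"
  shows "card ((\<lambda>s. l_coset G s B) ` A) \<le> k"
proof -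
  have A: "subgroup A G" and B: "subgroup B G" "B \<subseteq> A" and le: "card A \<le> k * card B"
    using AB by (simp_all add: index_bounded_def)
  have finA: "finite A" using fin subgroup.subset[OF A] finite_subset by blast
  have "card ((\<lambda>s. l_coset G s B) ` A) * card B \<le> card A"
  proof (rule card_image_mult_card_le[OF A finA B])
    fix s b assume sb: "s \<in> A" "b \<in> B"
    have s: "s \<in> carrier G" "b \<in> carrier G"
      using sb subgroup.mem_carrier[OF A] subgroup.mem_carrier[OF B(1)] by simp_all
    have "l_coset G (s \<otimes> b) B = l_coset G s (l_coset G b B)"
      by (rule lcos_m_assoc[symmetric]) (use s subgroup.subset[OF B(1)] in simp_all)
    also have "l_coset G b B = B" by (rule coset_join3[OF s(2) B(1) sb(2)])
    finally show "l_coset G (s \<otimes> b) B = l_coset G s B" .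
  qed
  then have "card ((\<lambda>s. l_coset G s B) ` A) * card B \<le> k * card B" using le by (rule le_trans)
  moreover have "0 < card B"
    using subgroup.one_closed[OF B(1)] finite_subset[OF B(2) finA] by (auto simp: card_gt_0_iff)
  ultimately show ?thesis by simp
qed

text \<open>Left cosets of \<open>B \<inter> C\<close> in \<open>A \<inter> C\<close> that lie in the same left coset of \<open>B\<close> are equal.\<close>

lemma index_bounded_Int:
  assumes fin: "finite (carrier G)" and AB: "index_bounded G k A B" and C: "subgroup C G"
  shows "index_bounded G k (A \<inter> C) (B \<inter> C)"
proof -
  have A: "subgroup A G" and B: "subgroup B G" "B \<subseteq> A"
    using AB by (simp_all add: index_bounded_def)
  have AC: "subgroup (A \<inter> C) G" and BC: "subgroup (B \<inter> C) G"
    using subgroups_Inter_pair A B(1) C by blast+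
  have finA: "finite A" using fin subgroup.subset[OF A] finite_subset by blast
  have "card (A \<inter> C) \<le> card ((\<lambda>s. l_coset G s B) ` (A \<inter> C)) * card (B \<inter> C)"
  proof (rule card_le_card_image_mult[OF AC])
    show "finite (A \<inter> C)" "finite (B \<inter> C)" using finA B(2) finite_subset by blast+
    fix s t assume st: "s \<in> A \<inter> C" "t \<in> A \<inter> C" "l_coset G s B = l_coset G t B"
    have car: "s \<in> carrier G" "t \<in> carrier G" using st subgroup.mem_carrier[OF C] by blast+
    have "t \<in> l_coset G s B" unfolding st(3) by (rule lcos_self[OF car(2) B(1)])
    then obtain b where b: "b \<in> B" "t = s \<otimes> b" by (auto simp: l_coset_def)
    have "b \<in> carrier G" using b(1) subgroup.mem_carrier[OF B(1)] by blast
    then have "inv s \<otimes> t = b" using car by (simp add: b(2) m_assoc[symmetric])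
    moreover have "inv s \<otimes> t \<in> C"
      using st subgroup.m_closed[OF C] subgroup.m_inv_closed[OF C] by blast
    ultimately show "inv s \<otimes> t \<in> B \<inter> C" using b(1) by simp
  qed
  also have "card ((\<lambda>s. l_coset G s B) ` (A \<inter> C)) \<le> card ((\<lambda>s. l_coset G s B) ` A)"
    using finA by (intro card_mono) auto
  then have "card ((\<lambda>s. l_coset G s B) ` (A \<inter> C)) * card (B \<inter> C) \<le> k * card (B \<inter> C)"
    using card_l_cosets_le[OF fin AB] by (intro mult_right_mono) auto
  finally show ?thesis using AC BC B(2) by (auto simp: index_bounded_def)
qed

text \<open>The image of \<open>A\<close> is the union of the images of the left cosets of \<open>B\<close>.\<close>

lemma index_bounded_hom_image:
  assumes fin: "finite (carrier G)" and AB: "index_bounded G k A B"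
    and H: "group H" and \<pi>: "\<pi> \<in> hom G H"
  shows "index_bounded H k (\<pi> ` A) (\<pi> ` B)"
proof -
  have A: "subgroup A G" and B: "subgroup B G" "B \<subseteq> A"
    using AB by (simp_all add: index_bounded_def)
  interpret \<pi>: group_hom G H \<pi>
    by (intro group_hom.intro group_hom_axioms.intro group_axioms H \<pi>)
  have finA: "finite A" using fin subgroup.subset[OF A] finite_subset by blast
  have finB: "finite B" using finite_subset[OF B(2) finA] .
  have BG: "B \<subseteq> carrier G" by (rule subgroup.subset[OF B(1)])
  let ?C = "(\<lambda>s. l_coset G s B) ` A"
  have "\<pi> ` A \<subseteq> (\<Union>c\<in>?C. \<pi> ` c)"
  proof
    fix y assume "y \<in> \<pi> ` A"
    then obtain s where s: "s \<in> A" "y = \<pi> s" by blast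
    have "s \<in> l_coset G s B" by (rule lcos_self[OF subgroup.mem_carrier[OF A s(1)] B(1)])
    then show "y \<in> (\<Union>c\<in>?C. \<pi> ` c)" using s by blast
  qed
  moreover have finc: "finite (\<pi> ` c)" "card (\<pi> ` c) \<le> card (\<pi> ` B)" if "c \<in> ?C" for c
  proof -
    obtain s where s: "s \<in> A" "c = l_coset G s B" using \<open>c \<in> ?C\<close> by blast
    have "s \<in> carrier G" by (rule subgroup.mem_carrier[OF A s(1)])
    then have "\<pi> ` c = (\<lambda>y. \<pi> s \<otimes>\<^bsub>H\<^esub> y) ` (\<pi> ` B)"
      unfolding s(2) l_coset_def using BG by (force simp: image_iff)
    then show "finite (\<pi> ` c)" "card (\<pi> ` c) \<le> card (\<pi> ` B)"
      using finB by (simp_all add: card_image_le)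
  qed
  ultimately have "card (\<pi> ` A) \<le> card (\<Union>c\<in>?C. \<pi> ` c)"
    using finA by (intro card_mono finite_UN_I) auto
  also have "\<dots> \<le> (\<Sum>c\<in>?C. card (\<pi> ` c))"
    by (rule card_UN_le) (use finA in simp)
  also have "\<dots> \<le> card ?C * card (\<pi> ` B)"
    using sum_bounded_above[of ?C "\<lambda>c. card (\<pi> ` c)" "card (\<pi> ` B)"] finc(2) by simp
  also have "\<dots> \<le> k * card (\<pi> ` B)"
    using card_l_cosets_le[OF fin AB] by (rule mult_right_mono) simp
  finally show ?thesis
    using \<pi>.subgroup_img_is_subgroup[OF A] \<pi>.subgroup_img_is_subgroup[OF B(1)] B(2)
    by (auto simp: index_bounded_def)
qed

lemma index_bounded_chain_Int:
  assumes "finite (carrier G)" "(index_bounded G k)\<^sup>*\<^sup>* A B" "subgroup C G"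
  shows "(index_bounded G k)\<^sup>*\<^sup>* (A \<inter> C) (B \<inter> C)"
  using assms(2)
proof (induction rule: rtranclp_induct)
  case (step Y Z)
  then show ?case
    using index_bounded_Int[OF assms(1) step(2) assms(3)] by (rule_tac rtranclp.rtrancl_into_rtrancl)
qed simp

lemma index_bounded_chain_hom_image:
  assumes "finite (carrier G)" "(index_bounded G k)\<^sup>*\<^sup>* A B" "group H" "\<pi> \<in> hom G H"
  shows "(index_bounded H k)\<^sup>*\<^sup>* (\<pi> ` A) (\<pi> ` B)"
  using assms(2)
proof (induction rule: rtranclp_induct)
  case (step Y Z)
  then show ?case
    using index_bounded_hom_image[OF assms(1) step(2) assms(3,4)] by (rule_tac rtranclp.rtrancl_into_rtrancl)
qed simp

lemma index_bounded_chain_subgroup: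
  "(index_bounded G k)\<^sup>*\<^sup>* A B \<Longrightarrow> subgroup A G \<Longrightarrow> subgroup B G"
  by (induction rule: rtranclp_induct) (auto simp: index_bounded_def)

text \<open>
  A chain from \<open>G\<close> to \<open>B\<close> can be continued into the intersection of the conjugates of \<open>B\<close> by the
  elements of a finite set \<open>S\<close>: having reached \<open>N\<close>, intersect \<open>N\<close> with the conjugate of the chain
  from \<open>G\<close> to \<open>B\<close>.
\<close>

lemma index_bounded_chain_conjugates:
  assumes fin: "finite (carrier G)" and B: "(index_bounded G k)\<^sup>*\<^sup>* (carrier G) B"
    and S: "finite S" "S \<subseteq> carrier G"
  shows "\<exists>N. (index_bounded G k)\<^sup>*\<^sup>* (carrier G) N \<and> (\<forall>g\<in>S. N \<subseteq> (\<lambda>x. g \<otimes> x \<otimes> inv g) ` B)"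
  using S
proof (induction S)
  case empty
  then show ?case by blast
next
  case (insert g S)
  then obtain N where N: "(index_bounded G k)\<^sup>*\<^sup>* (carrier G) N"
    "\<forall>h\<in>S. N \<subseteq> (\<lambda>x. h \<otimes> x \<otimes> inv h) ` B" by auto
  have g: "g \<in> carrier G" using insert by simp
  have NG: "subgroup N G" by (rule index_bounded_chain_subgroup[OF N(1) subgroup_self])
  let ?c = "\<lambda>x. g \<otimes> x \<otimes> inv g"
  have hom: "?c \<in> hom G G"
  proof (rule homI)
    fix x y assume xy: "x \<in> carrier G" "y \<in> carrier G"
    have "?c x \<otimes> ?c y = g \<otimes> x \<otimes> (inv g \<otimes> g) \<otimes> y \<otimes> inv g"
      using g xy by (simp only: m_assoc m_closed inv_closed)
    then show "?c (x \<otimes> y) = ?c x \<otimes> ?c y"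
      using g xy by (simp add: m_assoc)
  qed (use g in simp)
  have "?c ` carrier G = carrier G"
  proof (intro equalityI subsetI)
    fix x assume x: "x \<in> carrier G"
    have "x = ?c (inv g \<otimes> x \<otimes> g)"
    proof -
      have "?c (inv g \<otimes> x \<otimes> g) = (g \<otimes> inv g) \<otimes> x \<otimes> (g \<otimes> inv g)"
        using g x by (simp only: m_assoc m_closed inv_closed)
      then show ?thesis using g x by simp
    qed
    then show "x \<in> ?c ` carrier G" using g x by blast
  qed (use g in auto)
  then have "(index_bounded G k)\<^sup>*\<^sup>* (carrier G) (?c ` B)"
    using index_bounded_chain_hom_image[OF fin B is_group hom] by simp
  then have "(index_bounded G k)\<^sup>*\<^sup>* (carrier G \<inter> N) (?c ` B \<inter> N)"
    by (rule index_bounded_chain_Int[OF fin _ NG])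
  moreover have "carrier G \<inter> N = N" using subgroup.subset[OF NG] by blast
  ultimately have "(index_bounded G k)\<^sup>*\<^sup>* (carrier G) (?c ` B \<inter> N)"
    using N(1) by simp
  then show ?case using N(2) by blast
qed

text \<open>Omitting repetitions turns the closure into lists of strictly descending subgroups.\<close>

lemma index_bounded_chain_list:
  assumes "(index_bounded G k)\<^sup>*\<^sup>* A B" "subgroup B G"
  shows "\<exists>Hs. Hs \<noteq> [] \<and> hd Hs = A \<and> last Hs = B \<and> (\<forall>H\<in>set Hs. subgroup H G) \<and>
    successively (\<supset>) Hs \<and> successively (\<lambda>U V. card U \<le> k * card V) Hs"
  using assms(1)
proof (induction rule: converse_rtranclp_induct)
  case base
  then show ?case using assms(2) by (intro exI[of _ "[B]"]) simp
next
  case (step Y Z)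
  then obtain Hs where Hs: "Hs \<noteq> []" "hd Hs = Z" "last Hs = B" "\<forall>H\<in>set Hs. subgroup H G"
    "successively (\<supset>) Hs" "successively (\<lambda>U V. card U \<le> k * card V) Hs" by blast
  show ?case
  proof (cases "Y = Z")
    case True
    then show ?thesis using Hs by (intro exI[of _ Hs]) simp
  next
    case False
    then show ?thesis
      using Hs step(1) by (intro exI[of _ "Y # Hs"]) (auto simp: index_bounded_def successively_Cons)
  qed
qed

lemma subgroup_chain_sorted_wrt: "subgroup_chain G Hs \<Longrightarrow> sorted_wrt (\<supset>) Hs"
  unfolding subgroup_chain_def
  by (metis successively_conv_sorted_wrt transp_on_subset subset_UNIV transpI psubset_trans)

text \<open>
  A longest strict chain with indices at most \<open>k\<close> is maximal. For consecutive members \<open>U \<supset> V\<close> of a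
  refinement there are consecutive members \<open>X \<supset> Y\<close> of the original chain such that
  \<open>X \<supseteq> U \<supset> V \<supseteq> Y\<close>, so all indices in the refinement are at most \<open>k\<close> as well.
\<close>

lemma maximal_subgroup_chain_exists:
  assumes fin: "finite (carrier G)" and k: "1 \<le> k"
    and chain: "(index_bounded G k)\<^sup>*\<^sup>* (carrier G) {\<one>}"
  shows "\<exists>Hs. maximal_subgroup_chain G Hs \<and> chain_cost (subgroup_index G) Hs \<le> k"
proof -
  let ?P = "\<lambda>Hs. subgroup_chain G Hs \<and> successively (\<lambda>U V. card U \<le> k * card V) Hs"
  have "\<exists>Hs. ?P Hs"
    using index_bounded_chain_list[OF chain triv_subgroup] unfolding subgroup_chain_def by blast
  then obtain Hs0 where Hs0: "?P Hs0" by blast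
  have len: "length Hs \<le> card (Pow (carrier G))" if "?P Hs" for Hs
  proof -
    have "distinct Hs"
      using subgroup_chain_sorted_wrt[of Hs] that by (auto simp: sorted_wrt_iff_nth_less distinct_conv_nth nat_neq_iff)
    then have "length Hs = card (set Hs)" by (simp add: distinct_card)
    also have "\<dots> \<le> card (Pow (carrier G))"
      using that fin by (intro card_mono) (auto simp: subgroup_chain_def dest: subgroup.mem_carrier)
    finally show ?thesis .
  qed
  have "\<exists>Hs. ?P Hs \<and> (\<forall>Ks. ?P Ks \<longrightarrow> length Ks \<le> length Hs)"
    by (rule ex_has_greatest_nat[of ?P Hs0 length "Suc (card (Pow (carrier G)))"])
      (use Hs0 len in \<open>auto simp: less_Suc_eq_le\<close>)
  then obtain Hs where Hs: "?P Hs" and max: "\<And>Ks. ?P Ks \<Longrightarrow> length Ks \<le> length Hs" by blast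
  have cH: "Hs \<noteq> []" "hd Hs = carrier G" "last Hs = {\<one>}" "\<And>H. H \<in> set Hs \<Longrightarrow> subgroup H G"
    using Hs by (auto simp: subgroup_chain_def)
  have step: "card (Hs ! i) \<le> k * card (Hs ! Suc i)" if "Suc i < length Hs" for i
    using Hs that by (simp add: successively_conv_nth)
  have "\<not> strict_subseq Hs Ks" if Ks: "subgroup_chain G Ks" for Ks
  proof
    assume sub: "strict_subseq Hs Ks"
    then have emb: "subseq Hs Ks" "Hs \<noteq> Ks" by auto
    then have set: "set Hs \<subseteq> set Ks" by (auto elim: list_emb_set)
    have sorted: "Ks ! j \<subset> Ks ! i" if "i < j" "j < length Ks" for i j
      using subgroup_chain_sorted_wrt[OF Ks] that by (auto simp: sorted_wrt_iff_nth_less)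
    have Ksub: "subgroup (Ks ! i) G" if "i < length Ks" for i
      using Ks that by (auto simp: subgroup_chain_def)
    have "card (Ks ! i) \<le> k * card (Ks ! Suc i)" if i: "Suc i < length Ks" for i
    proof -
      have i': "i < length Ks" using i by simp
      \<comment> \<open>The smallest member of \<open>Hs\<close> that contains \<open>Ks ! i\<close>, that is, the one with largest index.\<close>
      let ?Q = "\<lambda>j. j < length Hs \<and> Ks ! i \<subseteq> Hs ! j"
      have "?Q 0"
        using cH(1,2) subgroup.subset[OF Ksub[OF i']] by (simp add: hd_conv_nth)
      then have "\<exists>j. ?Q j \<and> (\<forall>l. ?Q l \<longrightarrow> l \<le> j)"
        by (rule ex_has_greatest_nat[where f = "\<lambda>j. j" and b = "length Hs"]) auto
      then obtain j where j: "j < length Hs" "Ks ! i \<subseteq> Hs ! j" and jmax: "\<And>l. ?Q l \<Longrightarrow> l \<le> j"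
        by blast
      have "Suc j < length Hs"
      proof (rule ccontr)
        assume "\<not> ?thesis"
        then have "j = length Hs - 1" using j(1) by linarith
        then have "Hs ! j = {\<one>}" using cH(1,3) by (simp add: last_conv_nth)
        then have "Ks ! Suc i \<subset> {\<one>}" using j(2) sorted[OF lessI i] by auto
        then show False using subgroup.one_closed[OF Ksub[OF i]] by blast
      qed
      moreover have "\<not> Ks ! i \<subseteq> Hs ! Suc j" using jmax[of "Suc j"] \<open>Suc j < length Hs\<close> by auto
      moreover obtain l where l: "l < length Ks" "Hs ! Suc j = Ks ! l"
        using subsetD[OF set nth_mem[OF \<open>Suc j < length Hs\<close>]] by (auto simp: in_set_conv_nth)
      ultimately have "\<not> Ks ! i \<subseteq> Ks ! l" by simp
      then have "i < l" using sorted[of l i] i' by (cases l i rule: linorder_cases) auto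
      then have "Ks ! l \<subseteq> Ks ! Suc i"
        using sorted[of "Suc i" l] l(1) by (cases "l = Suc i") auto
      moreover have "finite (Ks ! Suc i)" "finite (Hs ! j)"
        using finite_subset[OF subgroup.subset fin] Ksub[OF i] cH(4)[OF nth_mem[OF j(1)]] by simp_all
      ultimately have "card (Hs ! Suc j) \<le> card (Ks ! Suc i)" "card (Ks ! i) \<le> card (Hs ! j)"
        using j(2) l(2) by (auto intro: card_mono)
      then show ?thesis
        using step[OF \<open>Suc j < length Hs\<close>] by (meson le_trans mult_le_mono2)
    qed
    then have "?P Ks" using Ks by (simp add: successively_conv_nth)
    then have "length Ks \<le> length Hs" by (rule max)
    moreover have "length Hs < length Ks"
      using emb list_emb_length[OF emb(1)] subseq_same_length[OF emb(1)] by linarith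
    ultimately show False by simp
  qed
  then have "maximal_subgroup_chain G Hs" using Hs by (auto simp: maximal_subgroup_chain_def)
  moreover have "chain_cost (subgroup_index G) Hs \<le> k"
  proof (rule chain_cost_le[OF k])
    fix i assume i: "Suc i < length Hs"
    have S: "subgroup (Hs ! i) G" "subgroup (Hs ! Suc i) G" "Hs ! Suc i \<subseteq> Hs ! i"
      using cH(4) i Hs by (auto simp: subgroup_chain_def successively_conv_nth)
    have fini: "finite (Hs ! i)" using fin subgroup.subset[OF S(1)] finite_subset by blast
    have "subgroup_index G (Hs ! i) (Hs ! Suc i) * card (Hs ! Suc i) \<le> k * card (Hs ! Suc i)"
      using subgroup_index_mult_card[OF S(1) fini S(2,3)] step[OF i] by simp
    moreover have "0 < card (Hs ! Suc i)"
      using subgroup.one_closed[OF S(2)] finite_subset[OF S(3) fini] by (auto simp: card_gt_0_iff)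
    ultimately show "subgroup_index G (Hs ! i) (Hs ! Suc i) \<le> k" by simp
  qed
  ultimately show ?thesis by blast
qed

end


section \<open>The two index estimates\<close>

lemma field_autos_mono: "K \<subseteq> F \<Longrightarrow> field_autos M F \<subseteq> field_autos M K"
  by (auto simp: field_autos_def)

lemma field_autos_iff: "\<rat> \<subseteq> K \<Longrightarrow> \<sigma> \<in> field_autos M K \<longleftrightarrow> \<sigma> \<in> field_autos M \<rat> \<and> (\<forall>x\<in>K. \<sigma> x = x)"
  by (auto simp: field_autos_def)

lemma field_autos_fix_adjoin:
  assumes M: "subfield M CC" and s: "\<sigma> \<in> field_autos M \<rat>" and K: "subfield K CC" "K \<subseteq> M"
    and fixK: "\<And>a. a \<in> K \<Longrightarrow> \<sigma> a = a" and x: "x \<in> M" "\<sigma> x = x" and y: "y \<in> adjoin K x"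
  shows "\<sigma> y = y"
proof -
  obtain p where p: "p \<in> polys_over K" "y = poly p x"
    using y unfolding adjoin_eq_polys[OF K(1)] by auto
  show ?thesis
    using field_autos_poly[OF M s p(1) K(2) fixK x(1)] by (simp add: p(2) x(2))
qed

lemma finite_field_autos:
  assumes g: "g \<noteq> 0" and M: "M = splitting_field g"
  shows "finite (field_autos M \<rat>)"
proof -
  obtain t where t: "algebraic t" "splitting_field g = adjoin \<rat> t"
    by (rule splitting_field_eq_adjoin[OF g])
  have alg: "alg_over \<rat> t" using t(1) by (simp add: algebraic_iff_alg_over_Rats)
  have Mt: "M = adjoin \<rat> t" using t(2) M by simp
  have sF: "subfield M CC" unfolding Mt by (rule subfield_adjoin[OF subfield_Rats alg])
  have tM: "t \<in> M" unfolding Mt by (rule adjoin_mem[OF subfield_Rats])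
  have "inj_on (\<lambda>\<sigma>. \<sigma> t) (field_autos M \<rat>)"
  proof (rule inj_onI)
    fix \<sigma> \<tau> assume s: "\<sigma> \<in> field_autos M \<rat>" "\<tau> \<in> field_autos M \<rat>" "\<sigma> t = \<tau> t"
    have "\<sigma> y = \<tau> y" if y: "y \<in> M" for y
    proof -
      obtain p where p: "p \<in> polys_over \<rat>" "y = poly p t"
        using y unfolding Mt adjoin_eq_polys[OF subfield_Rats] by auto
      then show ?thesis
        using field_autos_poly_Rats[OF sF s(1) p(1) tM] field_autos_poly_Rats[OF sF s(2) p(1) tM] s(3) by simp
    qed
    then show "\<sigma> = \<tau>" by (rule field_autos_eqI[OF s(1,2)])
  qed
  moreover have "(\<lambda>\<sigma>. \<sigma> t) ` field_autos M \<rat> \<subseteq> {z. poly (min_poly \<rat> t) z = 0}"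
  proof (rule image_subsetI, rule CollectI)
    fix \<sigma> assume s: "\<sigma> \<in> field_autos M \<rat>"
    show "poly (min_poly \<rat> t) (\<sigma> t) = 0"
      using field_autos_poly_Rats[OF sF s min_poly_over[OF subfield_Rats alg] tM]
        min_poly_root[OF subfield_Rats alg] field_autos_arith(1)[OF sF s] by simp
  qed
  ultimately show ?thesis
    using poly_roots_finite[OF min_poly_nonzero[OF subfield_Rats alg]] by (rule inj_on_finite)
qed

lemma subgroup_field_autos:
  assumes M: "subfield M CC" and K: "\<rat> \<subseteq> K" "K \<subseteq> M"
  shows "subgroup (field_autos M K) (galois_group M \<rat>)"
proof -
  note QM = Rats_subset_subfield[OF M]
  interpret G: group "galois_group M \<rat>" by (rule group_galois_group[OF M QM])
  have C: "carrier (galois_group M \<rat>) = field_autos M \<rat>" by (rule carrier_galois_group)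
  show ?thesis
  proof (rule G.subgroupI)
    show "field_autos M K \<subseteq> carrier (galois_group M \<rat>)"
      unfolding C by (rule field_autos_mono[OF K(1)])
    have "(\<one>\<^bsub>galois_group M \<rat>\<^esub>) \<in> field_autos M K"
      using G.one_closed K(2) unfolding C field_autos_iff[OF K(1)] one_galois_group by auto
    then show "field_autos M K \<noteq> {}" by blast
  next
    fix s assume "s \<in> field_autos M K"
    then have s: "s \<in> field_autos M \<rat>" "\<forall>x\<in>K. s x = x" unfolding field_autos_iff[OF K(1)] by simp_all
    have "(inv\<^bsub>galois_group M \<rat>\<^esub> s) x = x" if x: "x \<in> K" for x
      using inv_galois_apply[OF M QM s(1) subsetD[OF K(2) x]] bspec[OF s(2) x] by simp
    moreover have "inv\<^bsub>galois_group M \<rat>\<^esub> s \<in> field_autos M \<rat>"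
      using G.inv_closed[of s] s(1) unfolding C by simp
    ultimately show "inv\<^bsub>galois_group M \<rat>\<^esub> s \<in> field_autos M K"
      unfolding field_autos_iff[OF K(1)] by simp
  next
    fix s t assume "s \<in> field_autos M K" "t \<in> field_autos M K"
    then have s: "s \<in> field_autos M \<rat>" "\<forall>x\<in>K. s x = x" and t: "t \<in> field_autos M \<rat>" "\<forall>x\<in>K. t x = x"
      unfolding field_autos_iff[OF K(1)] by simp_all
    have "(s \<otimes>\<^bsub>galois_group M \<rat>\<^esub> t) x = x" if x: "x \<in> K" for x
      using mult_galois_apply[OF M QM s(1) t(1) subsetD[OF K(2) x]] bspec[OF s(2) x] bspec[OF t(2) x] by simp
    moreover have "s \<otimes>\<^bsub>galois_group M \<rat>\<^esub> t \<in> field_autos M \<rat>"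
      using G.m_closed[of s t] s(1) t(1) unfolding C by simp
    ultimately show "s \<otimes>\<^bsub>galois_group M \<rat>\<^esub> t \<in> field_autos M K"
      unfolding field_autos_iff[OF K(1)] by simp
  qed
qed

text \<open>
  With \<open>F = K(k)\<close>, automorphisms over \<open>K\<close> that agree at \<open>k\<close> differ by an automorphism over \<open>F\<close>, and
  their values at \<open>k\<close> are among the \<open>[F : K]\<close> roots of its minimal polynomial over \<open>K\<close>.
\<close>

lemma index_bounded_field_autos:
  assumes g: "g \<noteq> 0" and M: "M = splitting_field g"
    and K: "subfield K CC" and F: "number_field F" and KF: "K \<subseteq> F" and FM: "F \<subseteq> M"
  shows "index_bounded (galois_group M \<rat>) (ring.dim CC K F) (field_autos M K) (field_autos M F)"
proof -
  have sM: "subfield M CC" using number_fieldD(1)[OF number_field_splitting_field[OF g]] M by simp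
  have QK: "\<rat> \<subseteq> K" by (rule Rats_subset_subfield[OF K])
  have QF: "\<rat> \<subseteq> F" using QK KF by (rule order_trans)
  have KM: "K \<subseteq> M" using KF FM by (rule order_trans)
  note QM = Rats_subset_subfield[OF sM]
  interpret G: group "galois_group M \<rat>" by (rule group_galois_group[OF sM QM])
  have A: "subgroup (field_autos M K) (galois_group M \<rat>)" and B: "subgroup (field_autos M F) (galois_group M \<rat>)"
    using subgroup_field_autos[OF sM QK KM] subgroup_field_autos[OF sM QF FM] by simp_all
  have finA: "finite (field_autos M K)" and finB: "finite (field_autos M F)"
    using finite_subset[OF field_autos_mono[OF QK] finite_field_autos[OF g M]]
      finite_subset[OF field_autos_mono[OF QF] finite_field_autos[OF g M]] by simp_all
  obtain k where k: "algebraic k" "k \<in> F" "F = adjoin \<rat> k" by (rule number_field_primitive_element[OF F])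
  have FK: "F = adjoin K k" by (rule adjoin_over_intermediate_field[OF K number_fieldD(1)[OF F] KF k(3)])
  have alg: "alg_over K k" using alg_over_mono[OF QK] k(1) by (simp add: algebraic_iff_alg_over_Rats)
  have kM: "k \<in> M" using k(2) FM by (rule_tac subsetD)
  have D: "s \<in> field_autos M \<rat>" "\<And>x. x \<in> K \<Longrightarrow> s x = x" if "s \<in> field_autos M K" for s
    using that unfolding field_autos_iff[OF QK] by simp_all
  have "card (field_autos M K) \<le> card ((\<lambda>\<sigma>. \<sigma> k) ` field_autos M K) * card (field_autos M F)"
  proof (rule G.card_le_card_image_mult[OF A finA finB])
    fix s t assume st: "s \<in> field_autos M K" "t \<in> field_autos M K" "s k = t k"
    let ?u = "inv\<^bsub>galois_group M \<rat>\<^esub> s \<otimes>\<^bsub>galois_group M \<rat>\<^esub> t"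
    have u: "?u \<in> field_autos M K"
      by (intro subgroup.m_closed[OF A] subgroup.m_inv_closed[OF A] st)
    have "?u k = (inv\<^bsub>galois_group M \<rat>\<^esub> s) (t k)"
      by (rule mult_galois_apply[OF sM QM D(1)[OF subgroup.m_inv_closed[OF A st(1)]] D(1)[OF st(2)] kM])
    also have "\<dots> = k" using inv_galois_apply[OF sM QM D(1)[OF st(1)] kM] st(3) by simp
    finally have uk: "?u k = k" .
    have "?u y = y" if "y \<in> F" for y
      by (rule field_autos_fix_adjoin[OF sM D(1)[OF u] K KM D(2)[OF u] kM uk]) (use that FK in simp_all)
    then show "?u \<in> field_autos M F"
      using D(1)[OF u] unfolding field_autos_iff[OF QF] by simp
  qed
  also have "card ((\<lambda>\<sigma>. \<sigma> k) ` field_autos M K) \<le> ring.dim CC K F"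
  proof -
    have "(\<lambda>\<sigma>. \<sigma> k) ` field_autos M K \<subseteq> {z. poly (min_poly K k) z = 0}"
    proof (rule image_subsetI, rule CollectI)
      fix s assume s: "s \<in> field_autos M K"
      show "poly (min_poly K k) (s k) = 0"
        using field_autos_poly[OF sM D(1)[OF s] min_poly_over[OF K alg] KM D(2)[OF s] kM]
          min_poly_root[OF K alg] field_autos_arith(1)[OF sM s] by simp
    qed
    then have "card ((\<lambda>\<sigma>. \<sigma> k) ` field_autos M K) \<le> card {z. poly (min_poly K k) z = 0}"
      by (rule card_mono[OF poly_roots_finite[OF min_poly_nonzero[OF K alg]]])
    also have "\<dots> = ring.dim CC K F"
      unfolding card_roots_rsquarefree[OF rsquarefree_min_poly[OF K alg]]
      by (subst FK) (rule dim_eq_degree_min_poly[OF K alg, symmetric])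
    finally show ?thesis .
  qed
  finally show ?thesis
    using A B field_autos_mono[OF KF] by (simp add: index_bounded_def)
qed

text \<open>
  A primitive element of the fixed field of \<open>H'\<close> has at most \<open>[H : H']\<close> images under \<open>H\<close>, and the
  polynomial with these roots has coefficients in the fixed field of \<open>H\<close>.
\<close>

lemma dim_fixed_field_le_subgroup_index:
  assumes g: "g \<noteq> 0" and L: "L = splitting_field g"
    and H: "subgroup H (galois_group L \<rat>)" and H': "subgroup H' (galois_group L \<rat>)" "H' \<subseteq> H"
  shows "ring.dim CC (fixed_field L H) (fixed_field L H') \<le> subgroup_index (galois_group L \<rat>) H H'"
proof -
  let ?G = "galois_group L \<rat>" and ?F = "fixed_field L H" and ?F' = "fixed_field L H'"
  have nL: "number_field L" using number_field_splitting_field[OF g] L by simp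
  note sL = number_fieldD(1)[OF nL]
  note QL = Rats_subset_subfield[OF sL]
  interpret G: group ?G by (rule group_galois_group[OF sL QL])
  have HG: "H \<subseteq> field_autos L \<rat>" "H' \<subseteq> field_autos L \<rat>"
    using subgroup.subset[OF H] subgroup.subset[OF H'(1)] unfolding carrier_galois_group .
  have finH: "finite H" by (rule finite_subset[OF HG(1) finite_field_autos[OF g L]])
  have F: "subfield ?F CC" "subfield ?F' CC" by (rule subfield_fixed_field[OF sL HG(1)], rule subfield_fixed_field[OF sL HG(2)])
  have FF': "?F \<subseteq> ?F'" using H'(2) by (auto simp: fixed_field_def)
  have F'L: "?F' \<subseteq> L" by (auto simp: fixed_field_def)
  obtain k where k: "algebraic k" "k \<in> ?F'" "?F' = adjoin \<rat> k"
    by (rule number_field_primitive_element[OF number_field_subfield[OF nL F(2) F'L]])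
  have F'k: "?F' = adjoin ?F k" by (rule adjoin_over_intermediate_field[OF F(1,2) FF' k(3)])
  have alg: "alg_over ?F k"
    using alg_over_mono[OF Rats_subset_subfield[OF F(1)]] k(1) by (simp add: algebraic_iff_alg_over_Rats)
  have kL: "k \<in> L" using k(2) F'L by (rule_tac subsetD)
  let ?O = "(\<lambda>\<sigma>. \<sigma> k) ` H"
  have HD: "s \<in> field_autos L \<rat>" if "s \<in> H" for s using that HG(1) by (rule_tac subsetD)
  have OL: "?O \<subseteq> L" using field_autosD(1)[OF HD kL] by (rule image_subsetI)
  define P where "P = (\<Prod>x\<in>?O. [:- x, 1:])"
  have P: "P \<in> polys_over ?F"
    unfolding P_def
  proof (rule root_prod_over_fixed_field[OF sL HG(1) finite_imageI[OF finH] OL])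
    fix s assume s: "s \<in> H"
    show "s ` ?O \<subseteq> ?O"
      unfolding image_image
    proof (rule image_subsetI)
      fix t assume t: "t \<in> H"
      have "s (t k) = (s \<otimes>\<^bsub>?G\<^esub> t) k"
        by (rule mult_galois_apply[OF sL QL HD[OF s] HD[OF t] kL, symmetric])
      then show "s (t k) \<in> ?O" using subgroup.m_closed[OF H s t] by simp
    qed
  qed
  have "\<one>\<^bsub>?G\<^esub> k = k" using kL by (simp add: one_galois_group)
  then have "k \<in> ?O" using subgroup.one_closed[OF H] by (metis imageI)
  then have "poly P k = 0"
    unfolding P_def poly_prod using finH by (intro prod_zero) auto
  then have "min_poly ?F k dvd P" by (rule min_poly_dvd[OF F(1) alg P])
  moreover have "P \<noteq> 0" unfolding P_def using finH by simp
  ultimately have "Polynomial.degree (min_poly ?F k) \<le> Polynomial.degree P"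
    by (rule dvd_imp_degree_le)
  also have "\<dots> = card ?O" unfolding P_def by (subst degree_prod_sum_eq) simp_all
  also have "card ?O \<le> subgroup_index ?G H H'"
  proof -
    have "card ?O * card H' \<le> card H"
    proof (rule G.card_image_mult_card_le[OF H finH H'])
      fix s t assume st: "s \<in> H" "t \<in> H'"
      have "t k = k" using k(2) st(2) by (simp add: fixed_field_def)
      then show "(s \<otimes>\<^bsub>?G\<^esub> t) k = s k"
        using mult_galois_apply[OF sL QL HD[OF st(1)] HD[OF subsetD[OF H'(2) st(2)]] kL] by simp
    qed
    also have "\<dots> = subgroup_index ?G H H' * card H'"
      by (rule G.subgroup_index_mult_card[OF H finH H', symmetric])
    finally show ?thesis
      using subgroup.one_closed[OF H'(1)] finite_subset[OF H'(2) finH] by (auto simp: card_gt_0_iff)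
  qed
  finally show ?thesis
    using dim_eq_degree_min_poly[OF F(1) alg] F'k by simp
qed

section \<open>Transitivity and restriction of automorphisms\<close>

text \<open>
  The polynomial whose roots are the images of \<open>a\<close> under all automorphisms is rational, hence
  divisible by the minimal polynomial of \<open>a\<close>.
\<close>

lemma galois_transitive:
  assumes g: "g \<noteq> 0" and M: "M = splitting_field g" and a: "a \<in> M"
    and b: "poly (min_poly \<rat> a) b = 0"
  obtains \<sigma> where "\<sigma> \<in> field_autos M \<rat>" "\<sigma> a = b"
proof -
  have nM: "number_field M" using number_field_splitting_field[OF g] M by simp
  note sM = number_fieldD(1)[OF nM]
  note QM = Rats_subset_subfield[OF sM]
  interpret G: group "galois_group M \<rat>" by (rule group_galois_group[OF sM QM])
  have C: "carrier (galois_group M \<rat>) = field_autos M \<rat>" by (rule carrier_galois_group)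
  let ?O = "(\<lambda>\<sigma>. \<sigma> a) ` field_autos M \<rat>"
  have finO: "finite ?O" by (rule finite_imageI[OF finite_field_autos[OF g M]])
  have OM: "?O \<subseteq> M" using field_autosD(1)[OF _ a] by (rule image_subsetI)
  define P where "P = (\<Prod>x\<in>?O. [:- x, 1:])"
  have "P \<in> polys_over (fixed_field M (field_autos M \<rat>))"
    unfolding P_def
  proof (rule root_prod_over_fixed_field[OF sM order_refl finO OM])
    fix s assume s: "s \<in> field_autos M \<rat>"
    show "s ` ?O \<subseteq> ?O"
      unfolding image_image
    proof (rule image_subsetI)
      fix t assume t: "t \<in> field_autos M \<rat>"
      have "s (t a) = (s \<otimes>\<^bsub>galois_group M \<rat>\<^esub> t) a"
        by (rule mult_galois_apply[OF sM QM s t a, symmetric])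
      then show "s (t a) \<in> ?O" using G.m_closed[of s t] s t unfolding C by simp
    qed
  qed
  then have P: "P \<in> polys_over \<rat>" by (simp add: galois_fixed_field_Rats[OF g M])
  have "\<one>\<^bsub>galois_group M \<rat>\<^esub> a = a" using a by (simp add: one_galois_group)
  then have "a \<in> ?O" using G.one_closed unfolding C by (metis imageI)
  then have "poly P a = 0"
    unfolding P_def poly_prod using finO by (intro prod_zero) auto
  then have "min_poly \<rat> a dvd P"
    by (rule min_poly_dvd[OF subfield_Rats number_fieldD(3)[OF nM a] P])
  then have "poly P b = 0" using b by (rule poly_root_dvd_mono)
  then have "b \<in> ?O" unfolding P_def poly_prod using finO by (auto simp: prod_zero_iff)
  then show ?thesis using that by auto
qed

lemma galois_invariant_splitting_field:
  assumes M: "subfield M CC" and LM: "splitting_field f \<subseteq> M" and s: "\<sigma> \<in> field_autos M \<rat>"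
  shows "\<sigma> ` splitting_field f \<subseteq> splitting_field f"
proof -
  let ?L = "splitting_field f" and ?E = "{x \<in> splitting_field f. \<sigma> x \<in> splitting_field f}"
  have L: "subfield ?L CC" unfolding splitting_field_def by (rule subfield_generate_field)
  note S = subfield_CCD[OF L] and D = field_autosD[OF s] and E = field_autos_arith[OF M s]
  have m: "x \<in> M" if "x \<in> ?L" for x using that LM by (rule_tac subsetD)
  have "subfield ?E CC"
  proof (rule subfield_CCI)
    show "0 \<in> ?E" "1 \<in> ?E" using S(1,2) E(1) D(7) by simp_all
    show "- x \<in> ?E" "inverse x \<in> ?E" if "x \<in> ?E" for x
      using that S(5,7) E(2,3)[OF m[of x]] by simp_all
    show "x + y \<in> ?E" "x * y \<in> ?E" if "x \<in> ?E" "y \<in> ?E" for x y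
      using that S(3,4) D(5,6)[OF m[of x] m[of y]] by simp_all
  qed
  moreover have "complex_roots f \<subseteq> ?E"
  proof
    fix r assume r: "r \<in> complex_roots f"
    have rL: "r \<in> ?L" using r complex_roots_subset_splitting_field by (rule_tac subsetD)
    have "\<sigma> (poly (map_poly of_rat f) r) = poly (map_poly of_rat f) (\<sigma> r)"
      by (rule field_autos_poly_Rats[OF M s rat_poly_over_Rats m[OF rL]])
    then have "\<sigma> r \<in> complex_roots f" using r E(1) by (simp add: complex_roots_def)
    then have "\<sigma> r \<in> ?L" using complex_roots_subset_splitting_field by (rule_tac subsetD)
    with rL show "r \<in> ?E" by simp
  qed
  ultimately have "?L \<subseteq> ?E" by (rule splitting_field_least)
  then show ?thesis by blast
qed

lemma restrict_field_autos:
  assumes M: "subfield M CC" and L: "L = splitting_field f" and LM: "L \<subseteq> M" and s: "\<sigma> \<in> field_autos M \<rat>"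
  shows "restrict \<sigma> L \<in> field_autos L \<rat>"
proof -
  have sL: "subfield L CC" unfolding L splitting_field_def by (rule subfield_generate_field)
  note QM = Rats_subset_subfield[OF M] and S = subfield_CCD[OF sL] and D = field_autosD[OF s]
  interpret G: group "galois_group M \<rat>" by (rule group_galois_group[OF M QM])
  have m: "x \<in> M" if "x \<in> L" for x using that LM by (rule_tac subsetD)
  have inv: "\<tau> ` L \<subseteq> L" if "\<tau> \<in> field_autos M \<rat>" for \<tau>
    using galois_invariant_splitting_field[OF M _ that] LM L by simp
  have sc: "\<sigma> \<in> carrier (galois_group M \<rat>)" using s by (simp add: carrier_galois_group)
  let ?t = "inv\<^bsub>galois_group M \<rat>\<^esub> \<sigma>"
  have t: "?t \<in> field_autos M \<rat>" using G.inv_closed[OF sc] by (simp add: carrier_galois_group)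
  have "x \<in> \<sigma> ` L" if x: "x \<in> L" for x
  proof (rule image_eqI)
    show "?t x \<in> L" using inv[OF t] x by (rule_tac subsetD) auto
    show "x = \<sigma> (?t x)" using inv_galois_apply[OF M QM t m[OF x]] G.inv_inv[OF sc] by simp
  qed
  then have "\<sigma> ` L = L" using inv[OF s] by blast
  then have bij: "bij_betw (restrict \<sigma> L) L L"
    using inj_on_subset[OF D(3) LM] by (simp add: bij_betw_def inj_on_restrict_eq)
  show ?thesis
    unfolding field_autos_def
  proof (intro CollectI conjI ballI bij)
    show "restrict \<sigma> L \<in> extensional L" by simp
    show "restrict \<sigma> L 1 = 1" using S(2) D(7) by simp
    show "restrict \<sigma> L c = c" if "c \<in> \<rat>" for c
      using D(8)[OF that] subsetD[OF Rats_subset_subfield[OF sL] that] by simp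
    show "restrict \<sigma> L (y + z) = restrict \<sigma> L y + restrict \<sigma> L z"
      "restrict \<sigma> L (y * z) = restrict \<sigma> L y * restrict \<sigma> L z" if "y \<in> L" "z \<in> L" for y z
      using that S(3,4)[OF that] D(5,6)[OF m m, OF that] by simp_all
  qed
qed

lemma restrict_hom_galois_group:
  assumes M: "subfield M CC" and L: "L = splitting_field f" and LM: "L \<subseteq> M"
  shows "(\<lambda>\<sigma>. restrict \<sigma> L) \<in> hom (galois_group M \<rat>) (galois_group L \<rat>)"
proof (rule homI, unfold carrier_galois_group)
  note r = restrict_field_autos[OF M L LM]
  show "restrict s L \<in> field_autos L \<rat>" if "s \<in> field_autos M \<rat>" for s by (rule r[OF that])
  fix s t assume st: "s \<in> field_autos M \<rat>" "t \<in> field_autos M \<rat>"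
  have sL: "subfield L CC" unfolding L splitting_field_def by (rule subfield_generate_field)
  have m: "x \<in> M" if "x \<in> L" for x using that LM by (rule_tac subsetD)
  show "restrict (s \<otimes>\<^bsub>galois_group M \<rat>\<^esub> t) L = restrict s L \<otimes>\<^bsub>galois_group L \<rat>\<^esub> restrict t L"
    unfolding mult_galois_group[OF st] mult_galois_group[OF r[OF st(1)] r[OF st(2)]]
  proof (rule ext)
    fix x show "restrict (compose M s t) L x = compose L (restrict s L) (restrict t L) x"
      using m[of x] field_autosD(1)[OF r[OF st(2)], of x] by (simp add: compose_def)
  qed
qed

text \<open>
  An automorphism of \<open>L\<close> is determined by its value at a primitive element \<open>t\<close>, and by transitivity
  some automorphism of \<open>M\<close> has the same value at \<open>t\<close>.
\<close>

lemma restrict_galois_group_surj: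
  assumes g: "g \<noteq> 0" and M: "M = splitting_field g"
    and f: "f \<noteq> 0" and L: "L = splitting_field f" and LM: "L \<subseteq> M"
  shows "(\<lambda>\<sigma>. restrict \<sigma> L) ` field_autos M \<rat> = field_autos L \<rat>"
proof
  have sM: "subfield M CC" using number_fieldD(1)[OF number_field_splitting_field[OF g]] M by simp
  show "(\<lambda>\<sigma>. restrict \<sigma> L) ` field_autos M \<rat> \<subseteq> field_autos L \<rat>"
    using restrict_field_autos[OF sM L LM] by (rule image_subsetI)
  obtain t where t: "algebraic t" "splitting_field f = adjoin \<rat> t"
    by (rule splitting_field_eq_adjoin[OF f])
  have alg: "alg_over \<rat> t" using t(1) by (simp add: algebraic_iff_alg_over_Rats)
  have Lt: "L = adjoin \<rat> t" using t(2) L by simp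
  have sL: "subfield L CC" unfolding Lt by (rule subfield_adjoin[OF subfield_Rats alg])
  have tL: "t \<in> L" unfolding Lt by (rule adjoin_mem[OF subfield_Rats])
  show "field_autos L \<rat> \<subseteq> (\<lambda>\<sigma>. restrict \<sigma> L) ` field_autos M \<rat>"
  proof
    fix s assume s: "s \<in> field_autos L \<rat>"
    have "poly (min_poly \<rat> t) (s t) = 0"
      using field_autos_poly_Rats[OF sL s min_poly_over[OF subfield_Rats alg] tL]
        min_poly_root[OF subfield_Rats alg] field_autos_arith(1)[OF sL s] by simp
    then obtain u where u: "u \<in> field_autos M \<rat>" "u t = s t"
      by (rule galois_transitive[OF g M subsetD[OF LM tL]])
    have r: "restrict u L \<in> field_autos L \<rat>" by (rule restrict_field_autos[OF sM L LM u(1)])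
    have "s = restrict u L"
    proof (rule field_autos_eqI[OF s r])
      fix y assume "y \<in> L"
      then obtain p where p: "p \<in> polys_over \<rat>" "y = poly p t"
        unfolding Lt adjoin_eq_polys[OF subfield_Rats] by auto
      show "s y = restrict u L y"
        using field_autos_poly_Rats[OF sL s p(1) tL] field_autos_poly_Rats[OF sL r p(1) tL] u(2) tL
        by (simp add: p(2))
    qed
    then show "s \<in> (\<lambda>\<sigma>. restrict \<sigma> L) ` field_autos M \<rat>" using u(1) by blast
  qed
qed


section \<open>Conjugates of a root\<close>

lemma polys_over_Rats_eq_map_of_rat:
  assumes "p \<in> polys_over \<rat>"
  obtains h where "map_poly of_rat h = p"
proof -
  define h where "h = map_poly (inv_into UNIV of_rat) p"
  have i: "of_rat (inv_into UNIV of_rat c) = c" if "c \<in> \<rat>" for c :: complex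
    using that by (simp add: Rats_def f_inv_into_f)
  have "inv_into UNIV of_rat (0 :: complex) = 0"
    using i[of 0] by (simp add: of_rat_eq_0_iff)
  then have "map_poly of_rat h = p"
    using assms by (intro poly_eqI) (simp add: h_def coeff_map_poly polys_over_def i)
  then show ?thesis by (rule that)
qed

lemma number_field_subset_splitting_field:
  assumes "number_field F"
  obtains g where "g \<noteq> 0" "F \<subseteq> splitting_field g"
proof -
  obtain k where k: "algebraic k" "k \<in> F" "F = adjoin \<rat> k" by (rule number_field_primitive_element[OF assms])
  have alg: "alg_over \<rat> k" using k(1) by (simp add: algebraic_iff_alg_over_Rats)
  obtain g where g: "map_poly of_rat g = min_poly \<rat> k"
    by (rule polys_over_Rats_eq_map_of_rat[OF min_poly_over[OF subfield_Rats alg]])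
  have "g \<noteq> 0" using min_poly_nonzero[OF subfield_Rats alg] g by (auto simp: map_poly_of_rat_eq_0)
  moreover have "k \<in> complex_roots g"
    using min_poly_root[OF subfield_Rats alg] by (simp add: complex_roots_def g)
  then have "k \<in> splitting_field g" using complex_roots_subset_splitting_field by (rule_tac subsetD)
  then have "F \<subseteq> splitting_field g"
    using adjoin_least[OF number_fieldD(1)[OF number_field_splitting_field[OF \<open>g \<noteq> 0\<close>]]
      number_fieldD(4)[OF number_field_splitting_field[OF \<open>g \<noteq> 0\<close>]]] k(3) by simp
  ultimately show ?thesis by (rule that)
qed

lemma map_poly_of_rat_add:
  "map_poly of_rat (p + q) = map_poly of_rat p + (map_poly of_rat q :: complex poly)"
  by (intro poly_eqI) (simp add: coeff_map_poly of_rat_add)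

lemma map_poly_of_rat_mult:
  "map_poly of_rat (p * q) = map_poly of_rat p * (map_poly of_rat q :: complex poly)"
  by (intro poly_eqI) (simp add: coeff_map_poly coeff_mult of_rat_sum of_rat_mult)

text \<open>
  All roots of an irreducible polynomial \<open>f\<close> are conjugate: over the rationals \<open>f\<close> is not coprime to
  the minimal polynomial of \<open>a\<close>, since both have the root \<open>a\<close>, so \<open>f\<close> divides this polynomial.
\<close>

lemma complex_roots_irreducible:
  assumes f: "Factorial_Ring.irreducible f" and a: "a \<in> complex_roots f" and b: "b \<in> complex_roots f"
  shows "poly (min_poly \<rat> a) b = 0"
proof -
  have f0: "f \<noteq> 0" using f by (auto simp: Factorial_Ring.irreducible_def)
  have alg: "alg_over \<rat> a" using algebraic_complex_roots[OF f0 a] by (simp add: algebraic_iff_alg_over_Rats)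
  obtain h where h: "map_poly of_rat h = min_poly \<rat> a"
    by (rule polys_over_Rats_eq_map_of_rat[OF min_poly_over[OF subfield_Rats alg]])
  have ra: "poly (map_poly of_rat f) a = 0" using a by (simp add: complex_roots_def)
  have ha: "poly (map_poly of_rat h) a = 0" unfolding h by (rule min_poly_root[OF subfield_Rats alg])
  have "f dvd h"
  proof (rule ccontr)
    assume "\<not> f dvd h"
    then have "coprime f h"
      using f by (metis irreducible_imp_prime_elem prime_elem_imp_coprime)
    then obtain u v where "u * f + v * h = 1"
      by (metis bezout_coefficients_fst_snd coprime_imp_gcd_eq_1)
    then have "poly (map_poly of_rat (u * f + v * h)) a = 1" by simp
    then show False using ra ha by (simp add: map_poly_of_rat_add map_poly_of_rat_mult)
  qed
  then obtain q where "h = f * q" by (rule dvdE)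
  then have "poly (map_poly of_rat h) b = poly (map_poly of_rat f) b * poly (map_poly of_rat q) b"
    by (simp add: map_poly_of_rat_mult)
  then show ?thesis using b unfolding h by (simp add: complex_roots_def)
qed

section \<open>Comparison of the two widths\<close>

lemma one_le_dim:
  assumes K: "subfield K CC" and F: "number_field F" and KF: "K \<subseteq> F"
  shows "1 \<le> ring.dim CC K F"
proof -
  obtain k where k: "algebraic k" "k \<in> F" "F = adjoin \<rat> k" by (rule number_field_primitive_element[OF F])
  have FK: "F = adjoin K k" by (rule adjoin_over_intermediate_field[OF K number_fieldD(1)[OF F] KF k(3)])
  have alg: "alg_over K k"
    using alg_over_mono[OF Rats_subset_subfield[OF K]] k(1) by (simp add: algebraic_iff_alg_over_Rats)
  show ?thesis
    unfolding FK dim_eq_degree_min_poly[OF K alg] using degree_min_poly_pos[OF K alg] by simp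
qed

text \<open>The tower consists of the fixed fields of the chain.\<close>

theorem algorithm_of_subgroup_chain:
  assumes f: "f \<noteq> 0" and \<alpha>: "\<alpha> \<in> splitting_field f"
    and Hs: "subgroup_chain (galois_group (splitting_field f) \<rat>) Hs"
  shows "\<exists>Fs. algorithm_computing \<alpha> Fs \<and>
    chain_cost (\<lambda>K L. ring.dim CC K L) Fs \<le> chain_cost (subgroup_index (galois_group (splitting_field f) \<rat>)) Hs"
proof -
  define L where "L = splitting_field f"
  let ?G = "galois_group L \<rat>"
  have nL: "number_field L" unfolding L_def by (rule number_field_splitting_field[OF f])
  note sL = number_fieldD(1)[OF nL]
  have H: "Hs \<noteq> []" "hd Hs = carrier ?G" "last Hs = {\<one>\<^bsub>?G\<^esub>}" "\<And>H. H \<in> set Hs \<Longrightarrow> subgroup H ?G"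
    "\<And>i. Suc i < length Hs \<Longrightarrow> Hs ! Suc i \<subseteq> Hs ! i"
    using Hs unfolding subgroup_chain_def L_def[symmetric] by (auto simp: successively_conv_nth)
  define Fs where "Fs = map (fixed_field L) Hs"
  have "algorithm_computing \<alpha> Fs"
    unfolding algorithm_computing_def
  proof (intro conjI ballI)
    show "Fs \<noteq> []" using H(1) by (simp add: Fs_def)
    show "hd Fs = \<rat>"
      using H(1,2) galois_fixed_field_Rats[OF f L_def] by (simp add: Fs_def hd_map carrier_galois_group)
    show "\<alpha> \<in> last Fs"
      using H(1,3) \<alpha> by (simp add: Fs_def last_map fixed_field_def one_galois_group L_def)
    show "successively (\<subseteq>) Fs"
      unfolding successively_conv_nth
    proof (intro allI impI)
      fix i assume "Suc i < length Fs"
      then have i: "Suc i < length Hs" by (simp add: Fs_def)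
      show "Fs ! i \<subseteq> Fs ! Suc i" using H(5)[OF i] i by (auto simp: Fs_def fixed_field_def)
    qed
    fix F assume "F \<in> set Fs"
    then obtain H0 where H0: "H0 \<in> set Hs" "F = fixed_field L H0" by (auto simp: Fs_def)
    have "H0 \<subseteq> field_autos L \<rat>"
      using subgroup.subset[OF H(4)[OF H0(1)]] by (simp add: carrier_galois_group)
    then show "number_field F"
      unfolding H0(2)
      by (intro number_field_subfield[OF nL subfield_fixed_field[OF sL]]) (auto simp: fixed_field_def)
  qed
  moreover have "chain_cost (\<lambda>K L. ring.dim CC K L) Fs \<le> chain_cost (subgroup_index ?G) Hs"
  proof (cases "length Hs \<le> 1")
    case True
    then show ?thesis by (simp add: chain_cost_def Fs_def)
  next
    case False
    have idx: "ring.dim CC (Fs ! i) (Fs ! Suc i) \<le> chain_cost (subgroup_index ?G) Hs"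
      if "Suc i < length Fs" for i
    proof -
      have i: "Suc i < length Hs" using that by (simp add: Fs_def)
      have S: "subgroup (Hs ! i) ?G" "subgroup (Hs ! Suc i) ?G" using H(4) i by simp_all
      have "ring.dim CC (Fs ! i) (Fs ! Suc i) \<le> subgroup_index ?G (Hs ! i) (Hs ! Suc i)"
        using dim_fixed_field_le_subgroup_index[OF f L_def S H(5)[OF i]] i by (simp add: Fs_def)
      also have "\<dots> \<le> chain_cost (subgroup_index ?G) Hs" by (rule chain_cost_ge[OF i])
      finally show ?thesis .
    qed
    have l: "Suc 0 < length Fs" using False by (simp add: Fs_def)
    then have "Fs ! 0 \<in> set Fs" "Fs ! Suc 0 \<in> set Fs" using nth_mem[of 0 Fs] nth_mem[of "Suc 0" Fs] by linarith+
    then have "number_field (Fs ! 0)" "number_field (Fs ! Suc 0)" and "Fs ! 0 \<subseteq> Fs ! Suc 0"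
      using \<open>algorithm_computing \<alpha> Fs\<close> l unfolding algorithm_computing_def
      by (auto simp: successively_conv_nth)
    then have "1 \<le> ring.dim CC (Fs ! 0) (Fs ! Suc 0)"
      by (intro one_le_dim number_fieldD(1))
    then have "1 \<le> chain_cost (subgroup_index ?G) Hs" using idx[OF l] by linarith
    then show ?thesis by (rule chain_cost_le) (rule idx)
  qed
  ultimately show ?thesis unfolding L_def by blast
qed

text \<open>
  Here \<open>M\<close> is a splitting field that contains the whole tower, \<open>\<Gamma>\<close> its automorphism group, and \<open>N\<close> the
  end of the prolonged chain in \<open>\<Gamma>\<close>.
\<close>

theorem maximal_subgroup_chain_of_algorithm:
  assumes f: "Factorial_Ring.irreducible f" and \<alpha>: "\<alpha> \<in> complex_roots f"
    and Fs: "algorithm_computing \<alpha> Fs"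
  shows "\<exists>Hs. maximal_subgroup_chain (galois_group (splitting_field f) \<rat>) Hs \<and>
    chain_cost (subgroup_index (galois_group (splitting_field f) \<rat>)) Hs \<le> chain_cost (\<lambda>K L. ring.dim CC K L) Fs"
proof -
  define L where "L = splitting_field f"
  define k where "k = chain_cost (\<lambda>K L. ring.dim CC K L) Fs"
  have f0: "f \<noteq> 0" using f by (auto simp: Factorial_Ring.irreducible_def)
  have F: "Fs \<noteq> []" "hd Fs = \<rat>" "\<And>F. F \<in> set Fs \<Longrightarrow> number_field F"
    "\<And>i. Suc i < length Fs \<Longrightarrow> Fs ! i \<subseteq> Fs ! Suc i" "\<alpha> \<in> last Fs"
    using Fs unfolding algorithm_computing_def by (auto simp: successively_conv_nth)
  have mono: "Fs ! i \<subseteq> last Fs" if "i < length Fs" for i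
  proof -
    have "Fs ! i \<subseteq> Fs ! (length Fs - 1)"
    proof (rule dec_induct[of i "length Fs - 1" "\<lambda>j. Fs ! i \<subseteq> Fs ! j"])
      fix j assume "j < length Fs - 1" "Fs ! i \<subseteq> Fs ! j"
      moreover from this have "Fs ! j \<subseteq> Fs ! Suc j" by (intro F(4)) linarith
      ultimately show "Fs ! i \<subseteq> Fs ! Suc j" by (rule_tac order_trans)
    qed (use that in auto)
    then show ?thesis using F(1) by (simp add: last_conv_nth)
  qed
  obtain g where g: "g \<noteq> 0" and FM: "last Fs \<subseteq> splitting_field g"
    by (rule number_field_subset_splitting_field[OF F(3)[OF last_in_set[OF F(1)]]])
  define M where "M = splitting_field g"
  let ?\<Gamma> = "galois_group M \<rat>" and ?G = "galois_group L \<rat>"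
  have nM: "number_field M" unfolding M_def by (rule number_field_splitting_field[OF g])
  note sM = number_fieldD(1)[OF nM]
  note QM = Rats_subset_subfield[OF sM]
  have sL: "subfield L CC" unfolding L_def by (rule number_fieldD(1)[OF number_field_splitting_field[OF f0]])
  interpret \<Gamma>: group ?\<Gamma> by (rule group_galois_group[OF sM QM])
  interpret G: group ?G by (rule group_galois_group[OF sL Rats_subset_subfield[OF sL]])
  have fin: "finite (carrier ?\<Gamma>)" "finite (carrier ?G)"
    unfolding carrier_galois_group
    by (rule finite_field_autos[OF g M_def], rule finite_field_autos[OF f0 L_def])
  have \<alpha>M: "\<alpha> \<in> M" using F(5) FM unfolding M_def by (rule_tac subsetD)
  have conj: "\<exists>\<sigma>\<in>field_autos M \<rat>. \<sigma> \<alpha> = r" if r: "r \<in> complex_roots f" for r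
  proof -
    obtain \<sigma> where "\<sigma> \<in> field_autos M \<rat>" "\<sigma> \<alpha> = r"
      by (rule galois_transitive[OF g M_def \<alpha>M complex_roots_irreducible[OF f \<alpha> r]])
    then show ?thesis by (rule_tac bexI)
  qed
  have "complex_roots f \<subseteq> M"
  proof
    fix r assume "r \<in> complex_roots f"
    then obtain \<sigma> where "\<sigma> \<in> field_autos M \<rat>" "\<sigma> \<alpha> = r" using conj by blast
    then show "r \<in> M" using field_autosD(1)[OF _ \<alpha>M] by blast
  qed
  then have LM: "L \<subseteq> M" unfolding L_def by (rule splitting_field_least[OF sM])
  have tower: "(index_bounded ?\<Gamma> k)\<^sup>*\<^sup>* (field_autos M \<rat>) (field_autos M (Fs ! i))" if "i < length Fs" for i
    using that
  proof (induction i)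
    case 0
    then show ?case using F(1,2) by (simp add: hd_conv_nth)
  next
    case (Suc i)
    have m: "Fs ! Suc i \<in> set Fs" "Fs ! i \<in> set Fs" using Suc.prems by simp_all
    have "Fs ! Suc i \<subseteq> M" using mono[OF Suc.prems] FM unfolding M_def by (rule order_trans)
    then have "index_bounded ?\<Gamma> (ring.dim CC (Fs ! i) (Fs ! Suc i)) (field_autos M (Fs ! i)) (field_autos M (Fs ! Suc i))"
      by (rule index_bounded_field_autos[OF g M_def number_fieldD(1)[OF F(3)[OF m(2)]] F(3)[OF m(1)] F(4)[OF Suc.prems]])
    moreover have "ring.dim CC (Fs ! i) (Fs ! Suc i) \<le> k"
      unfolding k_def by (rule chain_cost_ge[OF Suc.prems])
    then have "ring.dim CC (Fs ! i) (Fs ! Suc i) * card (field_autos M (Fs ! Suc i)) \<le> k * card (field_autos M (Fs ! Suc i))"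
      by (rule mult_right_mono) simp
    ultimately have step: "index_bounded ?\<Gamma> k (field_autos M (Fs ! i)) (field_autos M (Fs ! Suc i))"
      unfolding index_bounded_def by (elim conjE) (intro conjI; (assumption | erule (1) order_trans))
    show ?case
      by (rule rtranclp.rtrancl_into_rtrancl[OF Suc.IH step]) (use Suc.prems in simp)
  qed
  let ?B = "field_autos M (last Fs)"
  have "(index_bounded ?\<Gamma> k)\<^sup>*\<^sup>* (carrier ?\<Gamma>) ?B"
    using tower[of "length Fs - 1"] F(1) by (simp add: carrier_galois_group last_conv_nth)
  then obtain N where N: "(index_bounded ?\<Gamma> k)\<^sup>*\<^sup>* (carrier ?\<Gamma>) N"
    and Nc: "\<And>h. h \<in> carrier ?\<Gamma> \<Longrightarrow> N \<subseteq> (\<lambda>x. h \<otimes>\<^bsub>?\<Gamma>\<^esub> x \<otimes>\<^bsub>?\<Gamma>\<^esub> inv\<^bsub>?\<Gamma>\<^esub> h) ` ?B"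
    using \<Gamma>.index_bounded_chain_conjugates[OF fin(1) _ fin(1) order_refl] by metis
  have NG: "subgroup N ?\<Gamma>" by (rule \<Gamma>.index_bounded_chain_subgroup[OF N \<Gamma>.subgroup_self])
  have BQ: "s \<in> field_autos M \<rat>" if "s \<in> ?B" for s
    using that field_autos_mono[OF number_fieldD(4)[OF F(3)[OF last_in_set[OF F(1)]]]] by (rule_tac subsetD)
  \<comment> \<open>An element \<open>\<sigma> = h s h\<^sup>-\<^sup>1\<close> with \<open>s \<alpha> = \<alpha>\<close> fixes \<open>h \<alpha>\<close>, and every root of \<open>f\<close> is of this form.\<close>
  have fixL: "\<sigma> x = x" if \<sigma>: "\<sigma> \<in> N" and x: "x \<in> L" for \<sigma> x
  proof -
    have \<sigma>M: "\<sigma> \<in> field_autos M \<rat>" using subgroup.mem_carrier[OF NG \<sigma>] by (simp add: carrier_galois_group)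
    have "complex_roots f \<subseteq> fixed_field M {\<sigma>}"
    proof
      fix r assume r: "r \<in> complex_roots f"
      obtain h where h: "h \<in> field_autos M \<rat>" "h \<alpha> = r" using conj[OF r] by (rule bexE)
      have hc: "h \<in> carrier ?\<Gamma>" using h(1) by (simp add: carrier_galois_group)
      obtain s where s: "s \<in> ?B" "\<sigma> = h \<otimes>\<^bsub>?\<Gamma>\<^esub> s \<otimes>\<^bsub>?\<Gamma>\<^esub> inv\<^bsub>?\<Gamma>\<^esub> h"
        using subsetD[OF Nc[OF hc] \<sigma>] by (rule imageE)
      have hs: "h \<otimes>\<^bsub>?\<Gamma>\<^esub> s \<in> field_autos M \<rat>" "inv\<^bsub>?\<Gamma>\<^esub> h \<in> field_autos M \<rat>"
        using \<Gamma>.m_closed[OF hc, of s] BQ[OF s(1)] \<Gamma>.inv_closed[OF hc] by (simp_all add: carrier_galois_group)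
      have rM: "r \<in> M" unfolding h(2)[symmetric] by (rule field_autosD(1)[OF h(1) \<alpha>M])
      have "\<sigma> r = (h \<otimes>\<^bsub>?\<Gamma>\<^esub> s) ((inv\<^bsub>?\<Gamma>\<^esub> h) (h \<alpha>))"
        unfolding s(2) h(2) by (rule mult_galois_apply[OF sM QM hs rM])
      also have "\<dots> = h (s \<alpha>)"
        using mult_galois_apply[OF sM QM h(1) BQ[OF s(1)] \<alpha>M] inv_galois_apply[OF sM QM h(1) \<alpha>M] by simp
      also have "s \<alpha> = \<alpha>" by (rule field_autosD(8)[OF s(1) F(5)])
      finally show "r \<in> fixed_field M {\<sigma>}" using rM h(2) by (simp add: fixed_field_def)
    qed
    then have "L \<subseteq> fixed_field M {\<sigma>}"
      unfolding L_def using \<sigma>M by (intro splitting_field_least subfield_fixed_field[OF sM]) simp_all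
    then show ?thesis using x by (auto simp: fixed_field_def)
  qed
  let ?\<pi> = "\<lambda>\<sigma>. restrict \<sigma> L"
  have "?\<pi> ` N = {\<one>\<^bsub>?G\<^esub>}"
  proof -
    have "?\<pi> \<sigma> = \<one>\<^bsub>?G\<^esub>" if "\<sigma> \<in> N" for \<sigma>
      unfolding one_galois_group by (rule restrict_ext) (rule fixL[OF that])
    moreover have "N \<noteq> {}" using subgroup.one_closed[OF NG] by (rule_tac notI) simp
    ultimately show ?thesis by (simp add: image_constant_conv cong: image_cong)
  qed
  moreover have "?\<pi> ` carrier ?\<Gamma> = carrier ?G"
    unfolding carrier_galois_group by (rule restrict_galois_group_surj[OF g M_def f0 L_def LM])
  ultimately have chain: "(index_bounded ?G k)\<^sup>*\<^sup>* (carrier ?G) {\<one>\<^bsub>?G\<^esub>}"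
    using \<Gamma>.index_bounded_chain_hom_image[OF fin(1) N G.is_group restrict_hom_galois_group[OF sM L_def LM]]
    by simp
  have "1 \<le> k"
  proof (cases "length Fs \<le> 1")
    case False
    then have l: "Suc 0 < length Fs" by simp
    then have m: "Fs ! 0 \<in> set Fs" "Fs ! Suc 0 \<in> set Fs" using nth_mem[of 0 Fs] nth_mem[of "Suc 0" Fs] by linarith+
    have "1 \<le> ring.dim CC (Fs ! 0) (Fs ! Suc 0)"
      by (rule one_le_dim[OF number_fieldD(1)[OF F(3)[OF m(1)]] F(3)[OF m(2)] F(4)[OF l]])
    also have "\<dots> \<le> k" unfolding k_def by (rule chain_cost_ge[OF l])
    finally show ?thesis .
  qed (simp add: k_def chain_cost_def)
  then show ?thesis
    using G.maximal_subgroup_chain_exists[OF fin(2) _ chain] unfolding k_def L_def by blast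
qed

text \<open>
  The tower from \<open>\<rat>\<close> to the splitting field computes \<open>\<alpha>\<close>, so both minima are attained, and the two
  comparisons bound each by the other.
\<close>

theorem theorem2:
  fixes f :: "rat poly" and \<alpha> :: complex
  assumes "Factorial_Ring.irreducible f"
    and "\<alpha> \<in> complex_roots f"
  shows "number_galois_width \<alpha> = group_galois_width (galois_group (splitting_field f) \<rat>)"
proof -
  let ?G = "galois_group (splitting_field f) \<rat>"
  have f0: "f \<noteq> 0" using assms(1) by (auto simp: Factorial_Ring.irreducible_def)
  have \<alpha>: "\<alpha> \<in> splitting_field f"
    using assms(2) complex_roots_subset_splitting_field by (rule_tac subsetD)
  let ?A = "\<lambda>c. \<exists>Fs. algorithm_computing \<alpha> Fs \<and> c = chain_cost (\<lambda>K L. ring.dim CC K L) Fs"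
  let ?B = "\<lambda>c. \<exists>Hs. maximal_subgroup_chain ?G Hs \<and> c = chain_cost (subgroup_index ?G) Hs"
  have AB: "\<exists>c'\<le>c. ?B c'" if "?A c" for c
    using that maximal_subgroup_chain_of_algorithm[OF assms] by blast
  have BA: "\<exists>c'\<le>c. ?A c'" if "?B c" for c
    using that algorithm_of_subgroup_chain[OF f0 \<alpha>] unfolding maximal_subgroup_chain_def by blast
  have "algorithm_computing \<alpha> [\<rat>, splitting_field f]"
    using \<alpha> number_field_splitting_field[OF f0]
      number_field_subfield[OF number_field_splitting_field[OF f0] subfield_Rats]
      number_fieldD(4)[OF number_field_splitting_field[OF f0]]
    by (simp add: algorithm_computing_def)
  then have exA: "\<exists>c. ?A c" by blast
  then have exB: "\<exists>c. ?B c" using AB by blast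
  show ?thesis
    unfolding number_galois_width_def group_galois_width_def
  proof (rule antisym)
    obtain c where c: "c \<le> (LEAST c. ?B c)" "?A c"
      using BA[OF LeastI_ex[OF exB]] by blast
    show "(LEAST c. ?A c) \<le> (LEAST c. ?B c)"
      by (rule order_trans[OF Least_le[of ?A c, OF c(2)] c(1)])
    obtain c where c: "c \<le> (LEAST c. ?A c)" "?B c"
      using AB[OF LeastI_ex[OF exA]] by blast
    show "(LEAST c. ?B c) \<le> (LEAST c. ?A c)"
      by (rule order_trans[OF Least_le[of ?B c, OF c(2)] c(1)])
  qed
qed

end
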